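(* Let $\mu\in\mathbb{R}$, let $M,N\in\mathbb{N}$ be positive integers, let $z\in\mathbb{C}\setminus(-\infty,0]$, and for $\sigma>0$ let $\phi(z)$ denote the (analytically continued) Laplace transform of $X\sim\mathrm{LN}(\mu,\sigma^2)$ at $z$. Then $$\phi(z)=\sum_{n=0}^N\frac{(-z)^n}{n!}e^{\mu n+\frac{\sigma^2}{2}n^2}\cdot\frac12\operatorname{erfc}\left(\frac{\mu+\ln z+\sigma^2 n}{\sqrt2\,\sigma}\right)+\sum_{m=0}^M\frac{(-1)^m a_m}{\sqrt{2\pi}\,\sigma^{m+1}}e^{-\frac{(\mu+\ln z)^2}{2\sigma^2}}H_m\left(-\frac{\mu+\ln z}{\sigma}\right)+O(\sigma^{-M-2})$$ as $\sigma\to\infty$ (with $\mu,z,M,N$ fixed), where $$a_m=\frac{\Gamma^{(m+1)}(1)}{(m+1)!}+(-1)^{m+1}\sum_{j=1}^N\frac{(-1)^j}{j!}\frac{1}{j^{m+1}}.$$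
   Context: $X\sim\mathrm{LN}(\mu,\sigma^2)$ (lognormal, $\mu\in\mathbb{R}$, $\sigma>0$) means that $X$ is a positive random variable with density $f(x)=\frac{1}{\sqrt{2\pi}\,\sigma x}\exp\left[-\frac{(\ln x-\mu)^2}{2\sigma^2}\right]$, $x>0$. Its Laplace transform is $\phi(z)=\mathbb{E}[e^{-zX}]$ for $\operatorname{Re}(z)\ge 0$, and $\phi$ also denotes the (unique) analytic continuation of this function from $\{\operatorname{Re}(z)>0\}$ to $\mathbb{C}\setminus(-\infty,0]$. Explicitly, for $z\in\mathbb{C}\setminus(-\infty,0]$, the continuation is $\phi(z)=(2\pi\sigma^2)^{-1/2}e^{-(\mu+\ln z)^2/(2\sigma^2)}\int_0^\infty \frac1x\exp\left[-x-\frac{(\ln x)^2}{2\sigma^2}+\frac{(\mu+\ln z)\ln x}{\sigma^2}\right]dx$. $\ln$ denotes the principal branch of the complex logarithm. $\operatorname{erfc}$ is the complementary error function, extended to an entire function: $\operatorname{erfc}(u)=1-\frac{2}{\sqrt\pi}\int_0^u e^{-v^2}dv$. $H_m$ is the $m$-th probabilist's Hermite polynomial, $H_m(x)=(-1)^m e^{x^2/2}\frac{d^m}{dx^m}e^{-x^2/2}$. $\Gamma^{(m+1)}$ is the $(m+1)$-th derivative of the gamma function. *)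

theory Defs
  imports
    "HOL-Probability.Probability"
    "HOL-Complex_Analysis.Complex_Analysis"
    "HOL-Library.Landau_Symbols"
begin

definition lognormal_density :: "real \<Rightarrow> real \<Rightarrow> real \<Rightarrow> real" where
  "lognormal_density \<mu> \<sigma> x =
     (if x > 0 then 1 / (sqrt (2 * pi) * \<sigma> * x) * exp (- (ln x - \<mu>)\<^sup>2 / (2 * \<sigma>\<^sup>2)) else 0)"

text \<open>
  Since the density vanishes on the nonpositive reals, \<open>X > 0\<close> holds almost surely; positivity
  is not required at every single point of the sample space.
\<close>

definition lognormal_distributed :: "'a measure \<Rightarrow> ('a \<Rightarrow> real) \<Rightarrow> real \<Rightarrow> real \<Rightarrow> bool" where
  "lognormal_distributed P X \<mu> \<sigma> \<longleftrightarrow>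
     prob_space P \<and> \<sigma> > 0 \<and> distributed P lborel X (\<lambda>x. ennreal (lognormal_density \<mu> \<sigma> x))"

definition laplace_transform :: "'a measure \<Rightarrow> ('a \<Rightarrow> real) \<Rightarrow> complex \<Rightarrow> complex" where
  "laplace_transform P X z = prob_space.expectation P (\<lambda>\<omega>. exp (- z * complex_of_real (X \<omega>)))"

definition is_laplace_continuation ::
    "'a measure \<Rightarrow> ('a \<Rightarrow> real) \<Rightarrow> (complex \<Rightarrow> complex) \<Rightarrow> bool" where
  "is_laplace_continuation P X f \<longleftrightarrow>
     f holomorphic_on (- \<real>\<^sub>\<le>\<^sub>0) \<and> (\<forall>s. Re s > 0 \<longrightarrow> f s = laplace_transform P X s)"

text \<open>
  A continuation is unique only on the slit plane, being arbitrary as a total function on the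
  slit, so the description operator is applied to the value at \<open>z\<close> and not to the function.
\<close>

definition laplace_continuation :: "'a measure \<Rightarrow> ('a \<Rightarrow> real) \<Rightarrow> complex \<Rightarrow> complex" where
  "laplace_continuation P X z = (THE w. \<exists>f. is_laplace_continuation P X f \<and> f z = w)"

lemma laplace_continuation_unique:
  assumes f: "is_laplace_continuation P X f" and g: "is_laplace_continuation P X g"
    and z: "z \<notin> \<real>\<^sub>\<le>\<^sub>0"
  shows "f z = g z"
proof -
  have op: "open {s. Re s > 0}" by (simp add: open_halfspace_Re_gt)
  have sub: "{s. Re s > 0} \<subseteq> - \<real>\<^sub>\<le>\<^sub>0" by (auto simp: complex_nonpos_Reals_iff)
  have "starlike (- \<real>\<^sub>\<le>\<^sub>0 :: complex set)"
  proof -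
    have "\<real>\<^sub>\<le>\<^sub>0 = complex_of_real ` {..0}" by (auto simp: nonpos_Reals_def)
    then show ?thesis using starlike_slotted_complex_plane_left[of 0] by simp
  qed
  then have conn: "connected (- \<real>\<^sub>\<le>\<^sub>0 :: complex set)"
    by (rule starlike_imp_connected)
  show ?thesis
  proof (rule analytic_continuation_open[of "{s. Re s > 0}" "- \<real>\<^sub>\<le>\<^sub>0" f g])
    show "{s. Re s > 0} \<noteq> {}" by (auto intro!: exI[of _ 1])
    show "open (- \<real>\<^sub>\<le>\<^sub>0 :: complex set)" by (simp add: open_Compl)
  qed (use op sub conn z f g in \<open>auto simp: is_laplace_continuation_def\<close>)
qed

lemma laplace_continuation_eq:
  assumes "is_laplace_continuation P X f" and "z \<notin> \<real>\<^sub>\<le>\<^sub>0"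
  shows "laplace_continuation P X z = f z"
  unfolding laplace_continuation_def
  using assms laplace_continuation_unique by (intro the_equality) blast+

definition erfc :: "complex \<Rightarrow> complex" where
  "erfc u = 1 - 2 / complex_of_real (sqrt pi) *
     contour_integral (linepath 0 u) (\<lambda>v. exp (- v\<^sup>2))"

text \<open>
  The Hermite polynomials are evaluated at complex arguments, so the derivative in the
  Rodrigues formula is the complex one.
\<close>

definition hermite :: "nat \<Rightarrow> complex \<Rightarrow> complex" where
  "hermite m x = (- 1) ^ m * exp (x\<^sup>2 / 2) * (deriv ^^ m) (\<lambda>t. exp (- t\<^sup>2 / 2)) x"

definition a_coeff :: "nat \<Rightarrow> nat \<Rightarrow> real" where
  "a_coeff N m =
     (deriv ^^ (m + 1)) Gamma 1 / fact (m + 1)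
     + (- 1) ^ (m + 1) * (\<Sum>j = 1..N. (- 1) ^ j / fact j * (1 / real j ^ (m + 1)))"

end

theory Submission
  imports Defs
begin

text \<open>
  Put \<open>L = \<mu> + ln z\<close>. The substitution \<open>x = exp y\<close>, a real translation for \<open>z > 0\<close> and analytic
  continuation represent the continued Laplace transform as the mean of \<open>exp (- exp y)\<close> against the
  Gaussian with complex mean \<open>L\<close> and variance \<open>\<sigma>\<^sup>2\<close>. Subtracting from \<open>exp (- exp y)\<close>, on the
  half line \<open>y \<le> 0\<close> only, its Taylor polynomial of degree \<open>N\<close> in \<open>exp y\<close> leaves a remainder \<open>R\<close>
  that decays exponentially in both directions. After completing the square, the subtracted terms
  integrate to the \<open>erfc\<close> sum. In the integral of \<open>R\<close> one expands the Gaussian in powers of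
  \<open>y / \<sigma>\<close>: its Taylor coefficients are Hermite polynomials, the moments of \<open>R\<close> are \<open>m! a\<^sub>m\<close>,
  and the Taylor error is uniform because all derivatives of the Gaussian are bounded on a strip.
\<close>

subsection \<open>Integration\<close>

text \<open>On the convex set \<open>S\<close> the mean value inequality bounds every difference
  quotient by \<open>g y\<close>, so dominated convergence applies along any sequence tending to
  \<open>w\<close>. The field is left general to serve both the real parameter of Gamma and complex
  parameters.\<close>

lemma has_field_derivative_lebesgue_integral:
  fixes f :: "'b \<Rightarrow> 'a :: {real_normed_field, banach, second_countable_topology} \<Rightarrow> 'a"
  assumes S: "open S" "convex S" "w \<in> S"
    and int: "\<And>x. x \<in> S \<Longrightarrow> integrable M (\<lambda>y. f y x)"
    and deriv: "\<And>x y. x \<in> S \<Longrightarrow> y \<in> space M \<Longrightarrow> (f y has_field_derivative f' y x) (at x)"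
    and meas: "(\<lambda>y. f' y w) \<in> borel_measurable M"
    and bound: "\<And>x y. x \<in> S \<Longrightarrow> y \<in> space M \<Longrightarrow> norm (f' y x) \<le> g y"
    and g: "integrable M g"
  shows "((\<lambda>x. \<integral>y. f y x \<partial>M) has_field_derivative (\<integral>y. f' y w \<partial>M)) (at w)"
proof -
  \<comment> \<open>The limit is first taken within \<open>S\<close>, where the bound by
    \<open>g\<close> holds; openness of \<open>S\<close> removes the restriction at the end.\<close>
  have "((\<lambda>x. ((\<integral>y. f y x \<partial>M) - (\<integral>y. f y w \<partial>M)) / (x - w)) \<longlongrightarrow> (\<integral>y. f' y w \<partial>M)) (at w within S)"
    unfolding tendsto_at_iff_sequentially
  proof (intro allI impI)
    fix X :: "nat \<Rightarrow> 'a" assume X: "\<forall>i. X i \<in> S - {w}" and lim: "X \<longlonglongrightarrow> w"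
    have XS: "X i \<in> S" and Xw: "X i \<noteq> w" for i using X by auto
    have *: "(\<lambda>i. \<integral>y. (f y (X i) - f y w) / (X i - w) \<partial>M) \<longlonglongrightarrow> (\<integral>y. f' y w \<partial>M)"
    proof (rule integral_dominated_convergence[where w = g])
      show "AE y in M. (\<lambda>i. (f y (X i) - f y w) / (X i - w)) \<longlonglongrightarrow> f' y w"
      proof (intro AE_I2)
        fix y assume "y \<in> space M"
        then have "((\<lambda>x. (f y x - f y w) / (x - w)) \<longlongrightarrow> f' y w) (at w)"
          using deriv S(3) by (simp add: has_field_derivative_iff)
        then show "(\<lambda>i. (f y (X i) - f y w) / (X i - w)) \<longlonglongrightarrow> f' y w"
          using Xw lim unfolding tendsto_at_iff_sequentially by (auto simp: o_def)
      qed
      show "AE y in M. norm ((f y (X i) - f y w) / (X i - w)) \<le> g y" for i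
      proof (intro AE_I2)
        fix y assume y: "y \<in> space M"
        have "norm (f y (X i) - f y w) \<le> g y * norm (X i - w)"
          using deriv[OF _ y] bound[OF _ y] XS S(3)
          by (intro field_differentiable_bound[OF S(2)]) (auto intro: has_field_derivative_at_within)
        then show "norm ((f y (X i) - f y w) / (X i - w)) \<le> g y"
          using Xw[of i] by (simp add: norm_divide divide_le_eq)
      qed
      show "(\<lambda>y. (f y (X i) - f y w) / (X i - w)) \<in> borel_measurable M" for i
        using int[OF XS[of i]] int[OF S(3)] by (intro borel_measurable_divide borel_measurable_diff) auto
    qed (use meas g in auto)
    have eq: "(\<integral>y. (f y (X i) - f y w) / (X i - w) \<partial>M)
        = ((\<integral>y. f y (X i) \<partial>M) - (\<integral>y. f y w \<partial>M)) / (X i - w)" for i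
      by (simp only: integral_divide_zero Bochner_Integration.integral_diff[OF int[OF XS] int[OF S(3)]])
    from * show "((\<lambda>x. ((\<integral>y. f y x \<partial>M) - (\<integral>y. f y w \<partial>M)) / (x - w)) \<circ> X)
        \<longlonglongrightarrow> (\<integral>y. f' y w \<partial>M)"
      unfolding eq o_def .
  qed
  then show ?thesis
    by (simp add: has_field_derivative_iff at_within_open[OF S(3,1)])
qed

text \<open>Substituting \<open>x = - n * y\<close> gives Euler's integral for
  \<open>fact k\<close>: the factor \<open>y ^ k\<close> contributes
  \<open>(- 1) ^ k / n ^ k\<close>, and the Jacobian supplies the remaining
  \<open>1 / n\<close>.\<close>

lemma has_bochner_integral_power_exp_atMost:
  fixes n :: real
  assumes "n > 0"
  shows "has_bochner_integral lborel (\<lambda>y. indicator {..0} y * (y ^ k * exp (n * y)))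
           ((- 1) ^ k * fact k / n ^ (k + 1))"
proof -
  have "has_bochner_integral lborel (\<lambda>x::real. x ^ k * exp (- x) * indicator {0..} x) (fact k)"
  proof (rule has_bochner_integral_nn_integral)
    have "(\<integral>\<^sup>+x. ennreal (x ^ k * exp (- x) * indicator {0..} x) \<partial>lborel)
        = (\<integral>\<^sup>+x. ennreal (x ^ k * exp (- x)) * indicator {0..} x \<partial>lborel)"
      by (intro nn_integral_cong) (simp split: split_indicator)
    also have "\<dots> = ennreal (fact k)"
      using nn_intergal_power_times_exp_Ici[of k] by simp
    finally show "(\<integral>\<^sup>+x. ennreal (x ^ k * exp (- x) * indicator {0..} x) \<partial>lborel) = ennreal (fact k)" .
  qed (auto split: split_indicator)
  from has_bochner_integral_mult_right[OF this, of "(- 1) ^ k / n ^ k"]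
  have *: "has_bochner_integral lborel
      (\<lambda>x::real. (- 1) ^ k / n ^ k * (x ^ k * exp (- x) * indicator {0..} x)) ((- 1) ^ k * fact k / n ^ k)"
    using assms by simp
  \<comment> \<open>The argument \<open>0 + - n * x\<close> has the shape \<open>t + c * x\<close>
    of the affine substitution rule.\<close>
  have eq: "(- 1) ^ k / n ^ k * ((0 + - n * x) ^ k * exp (- (0 + - n * x)) * indicator {0..} (0 + - n * x))
      = indicator {..0} x * (x ^ k * exp (n * x))" for x
  proof -
    have "(- n * x) ^ k = (- 1) ^ k * (n ^ k * x ^ k)"
      by (metis mult_minus_left power_minus power_mult_distrib)
    moreover have "0 \<le> - n * x \<longleftrightarrow> x \<le> 0"
      using assms by (simp add: mult_le_0_iff)
    ultimately show ?thesis
      using assms by (cases "x \<le> 0") simp_all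
  qed
  have "has_bochner_integral lborel (\<lambda>y. indicator {..0} y * (y ^ k * exp (n * y)))
      (((- 1) ^ k * fact k / n ^ k) /\<^sub>R \<bar>- n\<bar>)"
    using lborel_has_bochner_integral_real_affine_iff[THEN iffD1, OF _ *, of "- n" 0] assms
    unfolding eq by simp
  moreover have "((- 1) ^ k * fact k / n ^ k) /\<^sub>R \<bar>- n\<bar> = (- 1) ^ k * fact k / n ^ (k + 1)"
    using assms by (simp add: divide_inverse)
  ultimately show ?thesis by simp
qed

section \<open>Exponential weights, the substitution \<open>x = exp y\<close>, and the fundamental
  theorem on half lines\<close>

lemma integrable_exp_abs:
  fixes a :: real
  assumes "a > 0"
  shows "integrable lborel (\<lambda>y. exp (- a * \<bar>y\<bar>))"
proof -
  have 1: "integrable lborel (\<lambda>y. indicator {..0} y * exp (a * y))"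
    using has_bochner_integral_power_exp_atMost[OF assms, of 0] by (simp add: has_bochner_integral_iff)
  then have 2: "integrable lborel (\<lambda>y. indicator {..0} (- y) * exp (a * - y))"
    using lborel_integrable_real_affine[OF 1, of "-1" 0] by simp
  have "integrable lborel (\<lambda>y. indicator {..0} y * exp (a * y) + indicator {..0} (- y) * exp (a * - y))"
    by (intro Bochner_Integration.integrable_add 1 2)
  then show ?thesis
  proof (rule Bochner_Integration.integrable_bound)
    have "norm (exp (- a * \<bar>y\<bar>)) \<le> norm (indicator {..0} y * exp (a * y) + indicator {..0} (- y) * exp (a * - y))"
      for y :: real
      by (cases "y \<le> 0"; cases "y = 0") simp_all
    then show "AE y in lborel. norm (exp (- a * \<bar>y\<bar>))
        \<le> norm (indicator {..0} y * exp (a * y) + indicator {..0} (- y) * exp (a * - y))"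
      by simp
  qed simp
qed

text \<open>A single term of the exponential series at \<open>a * \<bar>y\<bar>\<close> is at most
  the whole sum.\<close>

lemma abs_power_le_exp:
  fixes y a :: real
  assumes "a > 0"
  shows "\<bar>y\<bar> ^ k \<le> fact k / a ^ k * exp (a * \<bar>y\<bar>)"
proof -
  have "(a * \<bar>y\<bar>) ^ k / fact k \<le> exp (a * \<bar>y\<bar>)"
    using assms summable_exp[of "a * \<bar>y\<bar>"] unfolding exp_def
    by (intro order_trans[OF _ sum_le_suminf[of _ "{k}"]]) (auto simp: divide_inverse mult.commute)
  then show ?thesis
    using assms by (simp add: power_mult_distrib field_simps)
qed

lemma integrable_abs_power_exp_abs:
  fixes a :: real
  assumes "a > 0"
  shows "integrable lborel (\<lambda>y. \<bar>y\<bar> ^ k * exp (- a * \<bar>y\<bar>))"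
proof (rule Bochner_Integration.integrable_bound)
  \<comment> \<open>Half of the decay rate is spent on absorbing the power; the other half keeps the
    integral finite.\<close>
  show "integrable lborel (\<lambda>y::real. fact k / (a / 2) ^ k * exp (- (a / 2) * \<bar>y\<bar>))"
    using assms by (intro integrable_mult_right integrable_exp_abs) simp
  show "AE y in lborel. norm (\<bar>y\<bar> ^ k * exp (- a * \<bar>y\<bar>)) \<le> norm (fact k / (a / 2) ^ k * exp (- (a / 2) * \<bar>y\<bar>))"
  proof (intro AE_I2)
    fix y :: real
    have "\<bar>y\<bar> ^ k * exp (- a * \<bar>y\<bar>) \<le> fact k / (a / 2) ^ k * exp (a / 2 * \<bar>y\<bar>) * exp (- a * \<bar>y\<bar>)"
      using abs_power_le_exp[of "a / 2" y k] assms by (intro mult_right_mono) auto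
    also have "\<dots> = fact k / (a / 2) ^ k * exp (- (a / 2) * \<bar>y\<bar>)"
      by (simp add: mult.assoc flip: exp_add)
    finally show "norm (\<bar>y\<bar> ^ k * exp (- a * \<bar>y\<bar>)) \<le> norm (fact k / (a / 2) ^ k * exp (- (a / 2) * \<bar>y\<bar>))"
      using assms by simp
  qed
qed simp

text \<open>Change of variables along the bijection \<open>exp\<close> onto the positive reals. It
  is applied to absolutely integrable functions for Lebesgue measure, and Borel measurability brings
  the result back to \<open>lborel\<close>.\<close>

lemma integrable_lborel_exp_substitution:
  fixes f :: "real \<Rightarrow> 'a :: euclidean_space"
  assumes "set_integrable lborel {0<..} f"
  shows "integrable lborel (\<lambda>y. exp y *\<^sub>R f (exp y))"
    and "(\<integral>y. exp y *\<^sub>R f (exp y) \<partial>lborel) = (LBINT x:{0<..}. f x)"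
proof -
  have range_exp: "range exp = {0::real<..}"
    by (auto simp: image_iff) (metis exp_ln)
  have "f absolutely_integrable_on {0<..}"
    using assms integrable_completion[of "\<lambda>x. indicator {0<..} x *\<^sub>R f x" lborel]
    by (auto simp: set_integrable_def)
  then have *: "(\<lambda>y. \<bar>exp y\<bar> *\<^sub>R f (exp y)) absolutely_integrable_on UNIV \<and>
      integral UNIV (\<lambda>y. \<bar>exp y\<bar> *\<^sub>R f (exp y)) = integral {0<..} f"
    by (subst has_absolute_integral_change_of_variables_real[where g = exp])
       (auto simp: range_exp intro: DERIV_exp inj_onI)
  \<comment> \<open>Only the restriction of \<open>f\<close> to positive arguments is known to be
    measurable; \<open>exp\<close> takes no other values, so the indicator disappears
    afterwards.\<close>
  have "(\<lambda>y. indicator {0<..} (exp y) *\<^sub>R f (exp y)) \<in> borel_measurable borel"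
    using borel_measurable_integrable[OF assms[unfolded set_integrable_def]]
    by (intro measurable_compose[of exp borel borel "\<lambda>x. indicator {0<..} x *\<^sub>R f x" borel]) auto
  then have meas: "(\<lambda>y. f (exp y)) \<in> borel_measurable borel" by simp
  show int: "integrable lborel (\<lambda>y. exp y *\<^sub>R f (exp y))"
    using * meas integrable_completion[of "\<lambda>y. exp y *\<^sub>R f (exp y)" lborel]
    by (auto simp: set_integrable_def)
  have "(\<integral>y. exp y *\<^sub>R f (exp y) \<partial>lborel) = integral UNIV (\<lambda>y. exp y *\<^sub>R f (exp y))"
    using integral_lborel[OF int] by simp
  also have "\<dots> = integral {0<..} f" using * by simp
  also have "\<dots> = (LBINT x:{0<..}. f x)"
    using set_borel_integral_eq_integral(2)[OF assms] by simp
  finally show "(\<integral>y. exp y *\<^sub>R f (exp y) \<partial>lborel) = (LBINT x:{0<..}. f x)" .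
qed

text \<open>The point 0 is a null set, so derivative and continuity are asked for at negative
  \<open>x\<close> only and a one-sided limit gives the boundary value. Functions that jump at 0 are
  thereby covered.\<close>

lemma integral_FTC_atMost_0:
  fixes F f :: "real \<Rightarrow> 'a :: euclidean_space"
  assumes deriv: "\<And>x. x < 0 \<Longrightarrow> (F has_vector_derivative f x) (at x)"
    and cont: "\<And>x. x < 0 \<Longrightarrow> isCont f x"
    and int: "integrable lborel (\<lambda>x. indicator {..0} x *\<^sub>R f x)"
    and lim: "(F \<longlongrightarrow> A) at_bot" "(F \<longlongrightarrow> B) (at_left 0)"
  shows "(\<integral>x. indicator {..0} x *\<^sub>R f x \<partial>lborel) = B - A"
proof -
  have sub: "einterval (-\<infinity>) (ereal 0) = {..<0}" by (auto simp: einterval_def)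
  have int': "set_integrable lborel (einterval (-\<infinity>) (ereal 0)) f"
    unfolding sub by (rule set_integrable_subset[of _ "{..0}"]) (use int in \<open>auto simp: set_integrable_def\<close>)
  have "(LBINT x=-\<infinity>..ereal 0. f x) = B - A"
    by (rule interval_integral_FTC_integrable[where F = F])
       (use deriv cont int' lim in \<open>auto simp: ereal_tendsto_simps\<close>)
  then have "(LBINT x:{..<0}. f x) = B - A"
    by (simp add: interval_lebesgue_integral_def sub)
  moreover have "(\<integral>x. indicator {..0} x *\<^sub>R f x \<partial>lborel) = (LBINT x:{..<0}. f x)"
    unfolding set_lebesgue_integral_def
  proof (rule integral_cong_AE)
    show "AE x in lborel. indicator {..0} x *\<^sub>R f x = indicator {..<0} x *\<^sub>R f x"
      using AE_lborel_singleton[of 0] by eventually_elim (auto split: split_indicator)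
  qed (use int' int in \<open>auto simp: set_integrable_def sub\<close>)
  ultimately show ?thesis by simp
qed

lemma integral_FTC_greaterThan_0:
  fixes F f :: "real \<Rightarrow> 'a :: euclidean_space"
  assumes deriv: "\<And>x. x > 0 \<Longrightarrow> (F has_vector_derivative f x) (at x)"
    and cont: "\<And>x. x > 0 \<Longrightarrow> isCont f x"
    and int: "integrable lborel (\<lambda>x. indicator {0<..} x *\<^sub>R f x)"
    and lim: "(F \<longlongrightarrow> A) (at_right 0)" "(F \<longlongrightarrow> B) at_top"
  shows "(\<integral>x. indicator {0<..} x *\<^sub>R f x \<partial>lborel) = B - A"
proof -
  have sub: "einterval (ereal 0) \<infinity> = {0<..}" by (auto simp: einterval_def)
  have "(LBINT x=ereal 0..\<infinity>. f x) = B - A"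
    by (rule interval_integral_FTC_integrable[where F = F])
       (use deriv cont int lim in \<open>auto simp: ereal_tendsto_simps sub set_integrable_def\<close>)
  then show ?thesis
    by (simp add: interval_lebesgue_integral_def sub set_lebesgue_integral_def)
qed

subsection \<open>Gaussian integrals with complex mean\<close>

text \<open>The normalising factor of the Gaussian density is left outside, and the mean
  \<open>w\<close> is complex because it will be \<open>\<mu> + ln z\<close>; the kernel is entire
  in \<open>w\<close>.\<close>

definition gauss_kernel :: "real \<Rightarrow> complex \<Rightarrow> real \<Rightarrow> complex" where
  "gauss_kernel \<sigma> w y = exp (- (of_real y - w)\<^sup>2 / of_real (2 * \<sigma>\<^sup>2))"

lemma borel_measurable_gauss_kernel [measurable]: "gauss_kernel \<sigma> w \<in> borel_measurable borel"
  unfolding gauss_kernel_def divide_inverse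
  by (intro borel_measurable_continuous_onI continuous_intros)

text \<open>The quadratic decay is traded for the linear exponent \<open>- \<bar>y\<bar>\<close>,
  with a constant that depends on \<open>w\<close> only through \<open>B\<close>. This uniformity is
  what domination over a ball of means requires.\<close>

lemma norm_gauss_kernel_le:
  assumes "\<sigma> > 0" and "norm w \<le> B"
  shows "norm (gauss_kernel \<sigma> w y) \<le> exp (\<sigma>\<^sup>2 + B\<^sup>2 / (2 * \<sigma>\<^sup>2)) * exp (- \<bar>y\<bar>)"
proof -
  define a b where "a = Re w" and "b = Im w"
  have "Re (- (of_real y - w)\<^sup>2 / of_real (2 * \<sigma>\<^sup>2)) = (b\<^sup>2 - (y - a)\<^sup>2) / (2 * \<sigma>\<^sup>2)"
    by (simp only: Re_divide_of_real) (simp add: power2_eq_square a_def b_def)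
  also have "\<dots> \<le> (2 * \<sigma>\<^sup>2 * \<sigma>\<^sup>2 + (a\<^sup>2 + b\<^sup>2) - 2 * \<sigma>\<^sup>2 * \<bar>y\<bar>) / (2 * \<sigma>\<^sup>2)"
  proof (rule divide_right_mono)
    \<comment> \<open>Half the sum of these two squares is exactly the difference between the two
      sides of the claim.\<close>
    have "0 \<le> (2 * \<sigma>\<^sup>2 - \<bar>y\<bar>)\<^sup>2" "0 \<le> (y - 2 * a)\<^sup>2" by simp_all
    then have "0 \<le> 4 * \<sigma>\<^sup>2 * \<sigma>\<^sup>2 - 4 * \<sigma>\<^sup>2 * \<bar>y\<bar> + y\<^sup>2" "0 \<le> y\<^sup>2 - 4 * a * y + 4 * a\<^sup>2"
      by (simp_all add: power2_diff power_mult_distrib power4_eq_xxxx power2_eq_square algebra_simps)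
    then show "b\<^sup>2 - (y - a)\<^sup>2 \<le> 2 * \<sigma>\<^sup>2 * \<sigma>\<^sup>2 + (a\<^sup>2 + b\<^sup>2) - 2 * \<sigma>\<^sup>2 * \<bar>y\<bar>"
      by (simp add: power2_diff algebra_simps)
  qed simp
  also have "\<dots> = \<sigma>\<^sup>2 + (norm w)\<^sup>2 / (2 * \<sigma>\<^sup>2) - \<bar>y\<bar>"
    using assms by (simp add: cmod_power2 a_def b_def field_simps)
  also have "\<dots> \<le> \<sigma>\<^sup>2 + B\<^sup>2 / (2 * \<sigma>\<^sup>2) - \<bar>y\<bar>"
    using assms by (intro diff_right_mono add_left_mono divide_right_mono power_mono) auto
  finally show ?thesis
    unfolding gauss_kernel_def norm_exp_eq_Re by (simp flip: exp_add)
qed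

lemma has_field_derivative_gauss_kernel:
  shows "((\<lambda>w. gauss_kernel \<sigma> w y) has_field_derivative
           (of_real y - w) / of_real (\<sigma>\<^sup>2) * gauss_kernel \<sigma> w y) (at w)"
proof -
  have "((\<lambda>w. - (of_real y - w)\<^sup>2) has_field_derivative 2 * (of_real y - w)) (at w)"
    by (auto intro!: derivative_eq_intros)
  from DERIV_chain2[OF DERIV_exp DERIV_cdivide[OF this, of "of_real (2 * \<sigma>\<^sup>2)"]]
  show ?thesis
    unfolding gauss_kernel_def by (rule DERIV_cong) (simp del: right_diff_distrib_numeral)
qed

text \<open>The kernel depends on \<open>y - w\<close> only, so this is the negative of the
  derivative in \<open>w\<close>. Hence the \<open>w\<close>-derivative of a half-line integral
  reduces to a boundary term.\<close>

lemma has_vector_derivative_gauss_kernel: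
  shows "(gauss_kernel \<sigma> w has_vector_derivative
           - ((of_real y - w) / of_real (\<sigma>\<^sup>2) * gauss_kernel \<sigma> w y)) (at y)"
proof -
  have "((\<lambda>u. - (u - w)\<^sup>2) has_field_derivative - (2 * (of_real y - w))) (at (of_real y))"
    by (auto intro!: derivative_eq_intros)
  from DERIV_chain2[OF DERIV_exp DERIV_cdivide[OF this, of "of_real (2 * \<sigma>\<^sup>2)"]]
  have "((\<lambda>u. exp (- (u - w)\<^sup>2 / of_real (2 * \<sigma>\<^sup>2))) has_field_derivative
           - ((of_real y - w) / of_real (\<sigma>\<^sup>2) * gauss_kernel \<sigma> w y)) (at (of_real y))"
    unfolding gauss_kernel_def by (rule DERIV_cong) (simp del: right_diff_distrib_numeral)
  from field_vector_diff_chain_at[OF has_vector_derivative_of_real[OF DERIV_ident] this]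
  show ?thesis by (simp add: o_def gauss_kernel_def[abs_def])
qed

text \<open>The bounded weight \<open>h\<close> allows both the indicator of a half line and
  \<open>exp (- exp y)\<close>.\<close>

lemma integrable_gauss_kernel:
  fixes h :: "real \<Rightarrow> real"
  assumes "\<sigma> > 0" and [measurable]: "h \<in> borel_measurable borel" and h: "\<And>y. \<bar>h y\<bar> \<le> 1"
  shows "integrable lborel (\<lambda>y. h y *\<^sub>R gauss_kernel \<sigma> w y)"
proof (rule Bochner_Integration.integrable_bound)
  let ?C = "exp (\<sigma>\<^sup>2 + (norm w)\<^sup>2 / (2 * \<sigma>\<^sup>2))"
  show "integrable lborel (\<lambda>y::real. ?C * exp (- \<bar>y\<bar>))"
    using integrable_exp_abs[of 1] by (intro integrable_mult_right) simp
  show "AE y in lborel. norm (h y *\<^sub>R gauss_kernel \<sigma> w y) \<le> norm (?C * exp (- \<bar>y\<bar>))"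
  proof (intro AE_I2)
    fix y
    have "norm (h y *\<^sub>R gauss_kernel \<sigma> w y) \<le> 1 * (?C * exp (- \<bar>y\<bar>))"
      unfolding norm_scaleR using h norm_gauss_kernel_le[OF assms(1) order_refl] by (intro mult_mono) auto
    then show "norm (h y *\<^sub>R gauss_kernel \<sigma> w y) \<le> norm (?C * exp (- \<bar>y\<bar>))" by simp
  qed
qed simp

text \<open>Differentiation under the integral on the unit ball around \<open>w\<close>: there every
  mean has norm at most \<open>B\<close>, so the derivative is dominated by a multiple of
  \<open>(\<bar>y\<bar> + B) * exp (- \<bar>y\<bar>)\<close>.\<close>

lemma
  fixes h :: "real \<Rightarrow> real"
  assumes "\<sigma> > 0" and [measurable]: "h \<in> borel_measurable borel" and h: "\<And>y. \<bar>h y\<bar> \<le> 1"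
  shows integrable_deriv_gauss_kernel:
      "integrable lborel (\<lambda>y. h y *\<^sub>R ((of_real y - w) / of_real (\<sigma>\<^sup>2) * gauss_kernel \<sigma> w y))"
    and has_field_derivative_integral_gauss_kernel:
      "((\<lambda>w. \<integral>y. h y *\<^sub>R gauss_kernel \<sigma> w y \<partial>lborel) has_field_derivative
        (\<integral>y. h y *\<^sub>R ((of_real y - w) / of_real (\<sigma>\<^sup>2) * gauss_kernel \<sigma> w y) \<partial>lborel)) (at w)"
proof -
  define B where "B = norm w + 1"
  define C where "C = exp (\<sigma>\<^sup>2 + B\<^sup>2 / (2 * \<sigma>\<^sup>2))"
  define g where "g y = C / \<sigma>\<^sup>2 * (\<bar>y\<bar> ^ 1 * exp (- 1 * \<bar>y\<bar>) + B * exp (- 1 * \<bar>y\<bar>))" for y :: real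
  have g: "integrable lborel g"
    unfolding g_def
    by (intro integrable_mult_right Bochner_Integration.integrable_add integrable_exp_abs
        integrable_abs_power_exp_abs) simp_all
  have bound: "norm (h y *\<^sub>R ((of_real y - v) / of_real (\<sigma>\<^sup>2) * gauss_kernel \<sigma> v y)) \<le> g y"
    if "v \<in> ball w 1" for v y
  proof -
    have v: "norm v \<le> B"
      using that norm_triangle_ineq2[of v w] by (simp add: B_def dist_norm norm_minus_commute)
    have "norm (h y *\<^sub>R ((of_real y - v) / of_real (\<sigma>\<^sup>2) * gauss_kernel \<sigma> v y))
        \<le> 1 * ((\<bar>y\<bar> + B) / \<sigma>\<^sup>2 * (C * exp (- \<bar>y\<bar>)))"
      unfolding norm_scaleR norm_mult norm_divide
    proof (intro mult_mono)
      show "norm (of_real y - v) / norm (of_real (\<sigma>\<^sup>2) :: complex) \<le> (\<bar>y\<bar> + B) / \<sigma>\<^sup>2"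
        using v norm_triangle_ineq4[of "of_real y" v] by (simp add: norm_power divide_right_mono)
      show "norm (gauss_kernel \<sigma> v y) \<le> C * exp (- \<bar>y\<bar>)"
        unfolding C_def by (rule norm_gauss_kernel_le[OF assms(1) v])
    qed (use h in \<open>auto simp: C_def B_def\<close>)
    also have "\<dots> = g y" by (simp add: g_def field_simps)
    finally show ?thesis .
  qed
  have [measurable]: "(\<lambda>y. h y *\<^sub>R ((of_real y - w) / of_real (\<sigma>\<^sup>2) * gauss_kernel \<sigma> w y)) \<in> borel_measurable lborel"
    by measurable
  show "integrable lborel (\<lambda>y. h y *\<^sub>R ((of_real y - w) / of_real (\<sigma>\<^sup>2) * gauss_kernel \<sigma> w y))"
    by (rule Bochner_Integration.integrable_bound[OF g])
       (use bound[of w] order_trans[OF _ abs_ge_self] in auto)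
  show "((\<lambda>w. \<integral>y. h y *\<^sub>R gauss_kernel \<sigma> w y \<partial>lborel) has_field_derivative
        (\<integral>y. h y *\<^sub>R ((of_real y - w) / of_real (\<sigma>\<^sup>2) * gauss_kernel \<sigma> w y) \<partial>lborel)) (at w)"
  proof (rule has_field_derivative_lebesgue_integral[where S = "ball w 1" and g = g])
    fix v y
    show "((\<lambda>w. h y *\<^sub>R gauss_kernel \<sigma> w y) has_field_derivative
        h y *\<^sub>R ((of_real y - v) / of_real (\<sigma>\<^sup>2) * gauss_kernel \<sigma> v y)) (at v)"
      unfolding scaleR_conv_of_real
      by (intro DERIV_cmult has_field_derivative_gauss_kernel)
  qed (use bound g assms in \<open>auto intro: integrable_gauss_kernel\<close>)
qed

section \<open>The error function as a half-line Gaussian integral\<close>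

lemma tendsto_gauss_kernel_at_bot:
  assumes "\<sigma> > 0"
  shows "(gauss_kernel \<sigma> w \<longlongrightarrow> 0) at_bot"
proof (rule tendsto_norm_zero_cancel, rule tendsto_sandwich)
  let ?C = "exp (\<sigma>\<^sup>2 + (norm w)\<^sup>2 / (2 * \<sigma>\<^sup>2))"
  show "((\<lambda>_. 0 :: real) \<longlongrightarrow> 0) (at_bot :: real filter)" by simp
  show "\<forall>\<^sub>F y in at_bot. norm (gauss_kernel \<sigma> w y) \<le> ?C * exp y"
    using eventually_le_at_bot[of 0]
  proof eventually_elim
    case (elim y)
    then show ?case using norm_gauss_kernel_le[OF assms order_refl, of w y] by simp
  qed
  show "((\<lambda>y. ?C * exp y) \<longlongrightarrow> 0) at_bot"
    using tendsto_mult_right_zero[OF exp_at_bot] by simp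
qed auto

text \<open>The integrand is entire and so has a primitive \<open>g\<close> on the whole plane; the
  contour integral is \<open>g u - g 0\<close>.\<close>

lemma has_field_derivative_erfc:
  "(erfc has_field_derivative - 2 / of_real (sqrt pi) * exp (- u\<^sup>2)) (at u)"
proof -
  obtain g :: "complex \<Rightarrow> complex" where g: "\<And>x. (g has_field_derivative exp (- x\<^sup>2)) (at x)"
  proof (rule holomorphic_convex_primitive'[of UNIV "\<lambda>v. exp (- v\<^sup>2)"])
    show "(\<lambda>v::complex. exp (- v\<^sup>2)) holomorphic_on UNIV" by (intro holomorphic_intros)
  qed auto
  have "contour_integral (linepath 0 u) (\<lambda>v. exp (- v\<^sup>2)) = g u - g 0" for u
    using contour_integral_primitive[of UNIV g "\<lambda>v. exp (- v\<^sup>2)" "linepath 0 u"] g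
    by (simp add: contour_integral_unique)
  then have eq: "erfc = (\<lambda>u. 1 - 2 / of_real (sqrt pi) * (g u - g 0))"
    by (simp add: erfc_def fun_eq_iff)
  show ?thesis
    unfolding eq
    by (rule DERIV_cong[OF DERIV_diff[OF DERIV_const DERIV_cmult[OF DERIV_diff[OF g DERIV_const]]]]) simp
qed

lemma erfc_0 [simp]: "erfc 0 = 1"
  by (simp add: erfc_def)

text \<open>Fixes the constant of integration for the general mean. The negative scaling factor
  reflects the known integral over \<open>{0..}\<close> to \<open>{..0}\<close>.\<close>

lemma integral_gauss_kernel_atMost_0_at_0:
  assumes "\<sigma> > 0"
  shows "(\<integral>y. indicator {..0} y *\<^sub>R gauss_kernel \<sigma> 0 y \<partial>lborel) = of_real (sqrt (2 * pi) * \<sigma> / 2)"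
proof -
  let ?f = "\<lambda>x::real. indicator {0..} x *\<^sub>R exp (- x\<^sup>2)"
  have c': "sqrt 2 * \<sigma> > 0" using assms by simp
  have c: "- 1 / (sqrt 2 * \<sigma>) \<noteq> 0" using assms by simp
  have "has_bochner_integral lborel (\<lambda>y. ?f (0 + - 1 / (sqrt 2 * \<sigma>) * y)) ((sqrt pi / 2) /\<^sub>R \<bar>- 1 / (sqrt 2 * \<sigma>)\<bar>)"
    by (rule lborel_has_bochner_integral_real_affine_iff[THEN iffD1, OF c gaussian_moment_0])
  also have "(\<lambda>y. ?f (0 + - 1 / (sqrt 2 * \<sigma>) * y)) = (\<lambda>y. indicator {..0} y *\<^sub>R exp (- y\<^sup>2 / (2 * \<sigma>\<^sup>2)))"
    using c' by (auto simp: fun_eq_iff indicator_def power_divide power_mult_distrib divide_le_0_iff)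
  finally have "(\<integral>y. indicator {..0} y *\<^sub>R exp (- y\<^sup>2 / (2 * \<sigma>\<^sup>2)) \<partial>lborel) = sqrt (2 * pi) * \<sigma> / 2"
    using assms by (simp add: has_bochner_integral_iff real_sqrt_mult)
  moreover have "indicator {..0} y *\<^sub>R gauss_kernel \<sigma> 0 y
      = complex_of_real (indicator {..0} y *\<^sub>R exp (- y\<^sup>2 / (2 * \<sigma>\<^sup>2)))" for y
    by (simp add: gauss_kernel_def scaleR_conv_of_real exp_of_real [symmetric])
  ultimately show ?thesis
    by (simp only: integral_complex_of_real)
qed

text \<open>As functions of \<open>w\<close> both sides are entire with the same derivative, and
  they agree at \<open>w = 0\<close>.\<close>

lemma integral_gauss_kernel_atMost_0:
  assumes "\<sigma> > 0"
  shows "(\<integral>y. indicator {..0} y *\<^sub>R gauss_kernel \<sigma> w y \<partial>lborel)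
       = of_real (sqrt (2 * pi) * \<sigma>) * (1 / 2 * erfc (w / of_real (sqrt 2 * \<sigma>)))"
proof -
  let ?h = "indicator {..0} :: real \<Rightarrow> real"
  let ?J = "\<lambda>w. (\<integral>y. ?h y *\<^sub>R gauss_kernel \<sigma> w y \<partial>lborel)"
  let ?E = "\<lambda>w. of_real (sqrt (2 * pi) * \<sigma>) * (1 / 2 * erfc (w / of_real (sqrt 2 * \<sigma>)))"
  have J: "(?J has_field_derivative - exp (- w\<^sup>2 / of_real (2 * \<sigma>\<^sup>2))) (at w)" for w
  proof -
    have h: "?h \<in> borel_measurable borel" "\<And>y. \<bar>?h y\<bar> \<le> 1" by (auto simp: indicator_def)
    \<comment> \<open>The differentiated integrand is the \<open>y\<close>-derivative of
      \<open>- gauss_kernel \<sigma> w\<close>, so only the boundary value at 0 survives.\<close>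
    have "(\<integral>y. ?h y *\<^sub>R ((of_real y - w) / of_real (\<sigma>\<^sup>2) * gauss_kernel \<sigma> w y) \<partial>lborel)
        = - gauss_kernel \<sigma> w 0 - 0"
    proof (rule integral_FTC_atMost_0[where F = "\<lambda>y. - gauss_kernel \<sigma> w y"])
      have "(gauss_kernel \<sigma> w has_vector_derivative
           - ((of_real y - w) / of_real (\<sigma>\<^sup>2) * gauss_kernel \<sigma> w y)) (at y)" for y
        using has_vector_derivative_gauss_kernel .
      note d = this has_vector_derivative_minus[OF this]
      then show "((\<lambda>y. - gauss_kernel \<sigma> w y) has_vector_derivative
          (of_real y - w) / of_real (\<sigma>\<^sup>2) * gauss_kernel \<sigma> w y) (at y)" for y
        by simp
      have c: "isCont (gauss_kernel \<sigma> w) y" for y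
        using d(1) by (rule has_vector_derivative_continuous)
      then show "isCont (\<lambda>y. (of_real y - w) / of_real (\<sigma>\<^sup>2) * gauss_kernel \<sigma> w y) y" for y
        unfolding divide_inverse by (intro continuous_intros) auto
      show "((\<lambda>y. - gauss_kernel \<sigma> w y) \<longlongrightarrow> 0) at_bot"
        using tendsto_minus[OF tendsto_gauss_kernel_at_bot[OF assms]] by simp
      show "((\<lambda>y. - gauss_kernel \<sigma> w y) \<longlongrightarrow> - gauss_kernel \<sigma> w 0) (at_left 0)"
        using c[of 0] by (intro tendsto_minus) (simp add: isCont_def filterlim_at_split)
    qed (rule integrable_deriv_gauss_kernel[OF assms h])
    also have "\<dots> = - exp (- w\<^sup>2 / of_real (2 * \<sigma>\<^sup>2))" by (simp add: gauss_kernel_def)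
    finally show ?thesis
      using has_field_derivative_integral_gauss_kernel[OF assms h, of w] by simp
  qed
  have E: "(?E has_field_derivative - exp (- w\<^sup>2 / of_real (2 * \<sigma>\<^sup>2))) (at w)" for w
  proof -
    have *: "((\<lambda>w. erfc (w / of_real (sqrt 2 * \<sigma>))) has_field_derivative
        (- 2 / of_real (sqrt pi) * exp (- (w / of_real (sqrt 2 * \<sigma>))\<^sup>2)) * (1 / of_real (sqrt 2 * \<sigma>))) (at w)"
      by (rule DERIV_chain2[OF has_field_derivative_erfc]) (intro DERIV_cdivide DERIV_ident)
    have sq: "(w / of_real (sqrt 2 * \<sigma>))\<^sup>2 = w\<^sup>2 / of_real (2 * \<sigma>\<^sup>2)"
      by (simp add: power_divide power_mult_distrib flip: of_real_power)
    show ?thesis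
      using DERIV_cmult[OF DERIV_cmult[OF *, of "1 / 2"], of "of_real (sqrt (2 * pi) * \<sigma>)"] assms
      unfolding sq by (simp add: real_sqrt_mult)
  qed
  have "\<exists>c. \<forall>w. ?J w - ?E w = c"
    using has_field_derivative_zero_constant[of UNIV "\<lambda>w. ?J w - ?E w"] DERIV_diff[OF J E] by auto
  then have "?J w - ?E w = ?J 0 - ?E 0" by metis
  also have "\<dots> = 0" using integral_gauss_kernel_atMost_0_at_0[OF assms] by simp
  finally show ?thesis by simp
qed

text \<open>Completing the square: the factor \<open>exp (n * y)\<close> moves the mean from
  \<open>w\<close> to \<open>w + \<sigma>\<^sup>2 * n\<close> and leaves a factor free of
  \<open>y\<close>.\<close>

lemma integral_exp_gauss_kernel_atMost_0:
  assumes "\<sigma> > 0"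
  shows "(\<integral>y. indicator {..0} y *\<^sub>R (exp (real n * y) *\<^sub>R gauss_kernel \<sigma> w y) \<partial>lborel)
       = of_real (sqrt (2 * pi) * \<sigma>) * (exp (of_nat n * w + of_real (\<sigma>\<^sup>2 / 2 * (real n)\<^sup>2)) *
          (1 / 2 * erfc ((w + of_real (\<sigma>\<^sup>2 * real n)) / of_real (sqrt 2 * \<sigma>))))"
    and "integrable lborel (\<lambda>y. indicator {..0} y *\<^sub>R (exp (real n * y) *\<^sub>R gauss_kernel \<sigma> w y))"
proof -
  let ?e = "exp (of_nat n * w + of_real (\<sigma>\<^sup>2 / 2 * (real n)\<^sup>2))"
  have "exp (real n * y) *\<^sub>R gauss_kernel \<sigma> w y = ?e * gauss_kernel \<sigma> (w + of_real (\<sigma>\<^sup>2 * real n)) y" for y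
  proof -
    have "of_real (real n * y) + - (of_real y - w)\<^sup>2 / of_real (2 * \<sigma>\<^sup>2)
       = of_nat n * w + of_real (\<sigma>\<^sup>2 / 2 * (real n)\<^sup>2)
         + - (of_real y - (w + of_real (\<sigma>\<^sup>2 * real n)))\<^sup>2 / of_real (2 * \<sigma>\<^sup>2)"
      using assms by (simp add: field_simps power2_eq_square)
    then show ?thesis
      unfolding gauss_kernel_def scaleR_conv_of_real exp_of_real[symmetric] exp_add[symmetric] by simp
  qed
  then have *: "(\<lambda>y. indicator {..0} y *\<^sub>R (exp (real n * y) *\<^sub>R gauss_kernel \<sigma> w y))
      = (\<lambda>y. ?e * (indicator {..0} y *\<^sub>R gauss_kernel \<sigma> (w + of_real (\<sigma>\<^sup>2 * real n)) y))"
    by simp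
  show "(\<integral>y. indicator {..0} y *\<^sub>R (exp (real n * y) *\<^sub>R gauss_kernel \<sigma> w y) \<partial>lborel)
       = of_real (sqrt (2 * pi) * \<sigma>) * (?e * (1 / 2 * erfc ((w + of_real (\<sigma>\<^sup>2 * real n)) / of_real (sqrt 2 * \<sigma>))))"
    unfolding * integral_mult_right_zero integral_gauss_kernel_atMost_0[OF assms] by simp
  show "integrable lborel (\<lambda>y. indicator {..0} y *\<^sub>R (exp (real n * y) *\<^sub>R gauss_kernel \<sigma> w y))"
    unfolding * by (intro integrable_mult_right integrable_gauss_kernel assms) (auto simp: indicator_def)
qed

subsection \<open>Moments of the remainder\<close>

text \<open>One term of the exponential series at \<open>exp y\<close>; it supplies any desired
  exponential decay rate \<open>p\<close> as \<open>y\<close> grows.\<close>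

lemma exp_neg_exp_le: "exp (- exp y) \<le> fact p * exp (- real p * y)" for y :: real
proof -
  have "exp y ^ p \<le> fact p / 1 ^ p * exp (1 * exp y)"
    using abs_power_le_exp[of 1 "exp y" p] by simp
  then have "exp (real p * y) \<le> fact p * exp (exp y)"
    unfolding exp_of_nat_mult by simp
  then show ?thesis
    by (simp add: exp_minus divide_simps)
qed

lemma has_field_derivative_exp_neg_exp:
  "((\<lambda>y. exp (- exp y)) has_field_derivative - (exp y * exp (- exp y))) (at y)" for y :: real
  by (auto intro!: derivative_eq_intros)

text \<open>Euler's integral under the substitution \<open>t = exp y\<close>, which moves the
  parameter \<open>s\<close> into an exponential that is easy to differentiate.\<close>

lemma Gamma_eq_integral_exp:
  assumes "s > (0::real)"
  shows "Gamma s = (\<integral>y. exp (s * y) * exp (- exp y) \<partial>lborel)"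
proof -
  have "((\<lambda>t. t powr (s - 1) / exp t) has_integral Gamma s) {0<..}"
  proof -
    have "((\<lambda>t. if t \<in> {0<..} then t powr (s - 1) / exp t else 0) has_integral Gamma s) {0..}"
      by (rule has_integral_eq[OF _ Gamma_integral_real[OF assms]]) auto
    then show ?thesis by (subst (asm) has_integral_restrict) auto
  qed
  moreover from this have "(\<lambda>t. t powr (s - 1) / exp t) absolutely_integrable_on {0<..}"
    by (intro nonnegative_absolutely_integrable_1) (auto simp: integrable_on_def)
  then have int: "set_integrable lborel {0<..} (\<lambda>t. t powr (s - 1) / exp t)"
    using integrable_completion[of "\<lambda>x. indicator {0<..} x *\<^sub>R (x powr (s - 1) / exp x)" lborel]
    by (simp add: set_integrable_def)
  ultimately have "Gamma s = (LBINT t:{0<..}. t powr (s - 1) / exp t)"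
    using set_borel_integral_eq_integral(2)[OF int] by (simp add: integral_unique)
  also have "\<dots> = (\<integral>y. exp y *\<^sub>R (exp y powr (s - 1) / exp (exp y)) \<partial>lborel)"
    by (rule integrable_lborel_exp_substitution(2)[OF int, symmetric])
  also have "\<dots> = (\<integral>y. exp (s * y) * exp (- exp y) \<partial>lborel)"
  proof (intro Bochner_Integration.integral_cong refl)
    fix y :: real
    have "exp y * exp ((s - 1) * y) = exp (s * y)"
      unfolding exp_add[symmetric] by (simp add: algebra_simps)
    then show "exp y *\<^sub>R (exp y powr (s - 1) / exp (exp y)) = exp (s * y) * exp (- exp y)"
      by (simp add: powr_def exp_minus divide_inverse flip: mult.assoc)
  qed
  finally show ?thesis .
qed

text \<open>For negative \<open>y\<close> the factor \<open>exp (s * y)\<close> decays at rate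
  \<open>s \<ge> a\<close>; for the others \<open>exp (- exp y)\<close> leaves the rate
  \<open>p - s \<ge> a\<close>. The bound is free of \<open>s\<close>, as differentiation in
  \<open>s\<close> demands.\<close>

lemma norm_power_exp_exp_le:
  fixes s y :: real
  assumes "a \<le> s" "s + a \<le> real p" "a > 0"
  shows "\<bar>y ^ k * (exp (s * y) * exp (- exp y))\<bar> \<le> fact p * (\<bar>y\<bar> ^ k * exp (- a * \<bar>y\<bar>))"
proof -
  have "exp (s * y) * exp (- exp y) \<le> fact p * exp (- a * \<bar>y\<bar>)"
  proof (cases "y \<ge> 0")
    case True
    have "exp (s * y) * exp (- exp y) \<le> exp (s * y) * (fact p * exp (- real p * y))"
      by (intro mult_left_mono exp_neg_exp_le) simp
    also have "\<dots> = fact p * exp ((s - real p) * y)"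
      by (simp add: left_diff_distrib exp_diff exp_minus divide_inverse)
    also have "\<dots> \<le> fact p * exp (- a * \<bar>y\<bar>)"
      using mult_right_mono[of "s - real p" "- a" y] assms True by simp
    finally show ?thesis .
  next
    case False
    have "exp (s * y) * exp (- exp y) \<le> exp (s * y) * 1"
      by (intro mult_left_mono) auto
    also have "\<dots> \<le> 1 * exp (- a * \<bar>y\<bar>)"
      using assms False by (auto intro!: mult_right_mono_neg)
    also have "\<dots> \<le> fact p * exp (- a * \<bar>y\<bar>)"
      by (intro mult_right_mono fact_ge_1) simp
    finally show ?thesis .
  qed
  then have "\<bar>y\<bar> ^ k * (exp (s * y) * exp (- exp y)) \<le> \<bar>y\<bar> ^ k * (fact p * exp (- a * \<bar>y\<bar>))"
    by (rule mult_left_mono) simp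
  then show ?thesis by (simp add: abs_mult power_abs mult_ac)
qed

text \<open>Each derivative in \<open>s\<close> brings down one factor \<open>y\<close> under the
  integral.\<close>

lemma
  assumes "s > (0::real)"
  shows integrable_power_exp_exp: "integrable lborel (\<lambda>y. y ^ k * (exp (s * y) * exp (- exp y)))"
    and higher_deriv_Gamma_real:
      "(deriv ^^ k) Gamma s = (\<integral>y. y ^ k * (exp (s * y) * exp (- exp y)) \<partial>lborel)"
proof -
  have int: "integrable lborel (\<lambda>y. y ^ k * (exp (s * y) * exp (- exp y)))"
    if "s > (0::real)" for s k
  proof -
    obtain p where p: "s + s \<le> real p" using real_arch_simple by blast
    show ?thesis
    proof (rule Bochner_Integration.integrable_bound)
      show "AE y in lborel. norm (y ^ k * (exp (s * y) * exp (- exp y)))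
          \<le> norm (fact p * (\<bar>y\<bar> ^ k * exp (- s * \<bar>y\<bar>)))"
        using norm_power_exp_exp_le[of s s p _ k] that p by (intro AE_I2) (simp add: abs_mult)
      show "integrable lborel (\<lambda>y. fact p * (\<bar>y\<bar> ^ k * exp (- s * \<bar>y\<bar>)))"
        by (intro integrable_mult_right integrable_abs_power_exp_abs that)
    qed simp
  qed
  show "integrable lborel (\<lambda>y. y ^ k * (exp (s * y) * exp (- exp y)))"
    by (rule int[OF assms])
  have step: "((\<lambda>s. \<integral>y. y ^ k * (exp (s * y) * exp (- exp y)) \<partial>lborel) has_field_derivative
      (\<integral>y. y ^ Suc k * (exp (s * y) * exp (- exp y)) \<partial>lborel)) (at s)" if s: "s > (0::real)" for s k
  proof -
    \<comment> \<open>With this \<open>p\<close> one dominating function, of rate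
      \<open>s / 2\<close>, serves all parameters between \<open>s / 2\<close> and
      \<open>2 * s\<close>.\<close>
    obtain p where p: "2 * s + s / 2 \<le> real p" using real_arch_simple by blast
    show ?thesis
    proof (rule has_field_derivative_lebesgue_integral[where S = "{s / 2<..<2 * s}"
          and g = "\<lambda>y. fact p * (\<bar>y\<bar> ^ Suc k * exp (- (s / 2) * \<bar>y\<bar>))"])
      show "norm (y ^ Suc k * (exp (x * y) * exp (- exp y))) \<le> fact p * (\<bar>y\<bar> ^ Suc k * exp (- (s / 2) * \<bar>y\<bar>))"
        if "x \<in> {s / 2<..<2 * s}" for x y
        using norm_power_exp_exp_le[of "s / 2" x p y "Suc k"] that p s by simp
      show "integrable lborel (\<lambda>y. fact p * (\<bar>y\<bar> ^ Suc k * exp (- (s / 2) * \<bar>y\<bar>)))"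
        using s by (intro integrable_mult_right integrable_abs_power_exp_abs) simp
      show "((\<lambda>s. y ^ k * (exp (s * y) * exp (- exp y))) has_field_derivative
          y ^ Suc k * (exp (x * y) * exp (- exp y))) (at x)" for x y :: real
        by (auto intro!: derivative_eq_intros)
    qed (use s in \<open>auto intro!: int\<close>)
  qed
  show "(deriv ^^ k) Gamma s = (\<integral>y. y ^ k * (exp (s * y) * exp (- exp y)) \<partial>lborel)"
    using assms
  proof (induction k arbitrary: s)
    case 0
    then show ?case by (simp add: Gamma_eq_integral_exp)
  next
    case (Suc k)
    have "(deriv ^^ Suc k) Gamma s = deriv (\<lambda>s. \<integral>y. y ^ k * (exp (s * y) * exp (- exp y)) \<partial>lborel) s"
      \<comment> \<open>The induction hypothesis holds for positive parameters only, so the two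
        functions are compared on a neighbourhood of \<open>s\<close>.\<close>
      unfolding funpow.simps o_def
      using Suc by (intro deriv_cong_ev refl) (auto intro!: eventually_mono[OF eventually_nhds_in_open[of "{0<..}"]])
    also have "\<dots> = (\<integral>y. y ^ Suc k * (exp (s * y) * exp (- exp y)) \<partial>lborel)"
      by (rule DERIV_imp_deriv[OF step[OF Suc.prems]])
    finally show ?case .
  qed
qed

text \<open>This is the \<open>R\<close> of the overview. The term \<open>n = 0\<close> cancels the
  limit 1 of \<open>exp (- exp y)\<close> at minus infinity; for \<open>y > 0\<close> nothing is
  subtracted, since the exponentials would grow there.\<close>

definition exp_exp_remainder :: "nat \<Rightarrow> real \<Rightarrow> real" where
  "exp_exp_remainder N y =
     exp (- exp y) - indicator {..0} y * (\<Sum>n = 0..N. (- 1) ^ n / fact n * exp (real n * y))"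

lemma borel_measurable_exp_exp_remainder [measurable]:
  "exp_exp_remainder N \<in> borel_measurable borel"
  unfolding exp_exp_remainder_def by measurable

text \<open>For \<open>y \<le> 0\<close>, \<open>exp (- exp y)\<close> differs from 1 by at most
  \<open>exp y\<close>, and each of the \<open>N\<close> terms with \<open>n \<ge> 1\<close> is at
  most \<open>exp y\<close>; this crude count gives \<open>N + 1\<close>. For positive
  \<open>y\<close> the decay rate 1 of \<open>exp (- exp y)\<close> is enough.\<close>

lemma abs_exp_exp_remainder_le: "\<bar>exp_exp_remainder N y\<bar> \<le> real (N + 1) * exp (- \<bar>y\<bar>)"
proof (cases "y \<le> 0")
  case True
  let ?S = "\<Sum>n = 1..N. (- 1) ^ n / fact n * exp (real n * y)"
  have S: "\<bar>?S\<bar> \<le> (\<Sum>n = 1..N. exp y)"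
  proof (rule order_trans[OF sum_abs], rule sum_mono)
    fix n assume "n \<in> {1..N}"
    then have "real n * y \<le> 1 * y"
      using True by (intro mult_right_mono_neg) auto
    moreover have "1 / fact n \<le> (1 :: real)" using fact_ge_1[of n] by (simp add: divide_simps)
    ultimately have "1 / fact n * exp (real n * y) \<le> 1 * exp y"
      by (intro mult_mono) auto
    then show "\<bar>(- 1) ^ n / fact n * exp (real n * y)\<bar> \<le> exp y"
      by (simp add: abs_mult power_abs)
  qed
  have "exp_exp_remainder N y = (exp (- exp y) - 1) - ?S"
    using True by (simp add: exp_exp_remainder_def sum.atLeast_Suc_atMost)
  then have "\<bar>exp_exp_remainder N y\<bar> \<le> \<bar>exp (- exp y) - 1\<bar> + \<bar>?S\<bar>"
    by (simp only: abs_triangle_ineq4)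
  also have "\<dots> \<le> exp y + (\<Sum>n = 1..N. exp y)"
    using exp_ge_add_one_self[of "- exp y"] by (intro add_mono S) simp
  finally show ?thesis
    using True by (simp add: algebra_simps)
next
  case False
  have "exp (- exp y) \<le> 1 * exp (- y)"
    using exp_neg_exp_le[of y 1] by simp
  also have "\<dots> \<le> real (N + 1) * exp (- y)"
    by (intro mult_right_mono) auto
  finally show ?thesis
    using False by (simp add: exp_exp_remainder_def)
qed

lemma integrable_power_exp_exp_remainder: "integrable lborel (\<lambda>y. \<bar>y\<bar> ^ k * \<bar>exp_exp_remainder N y\<bar>)"
proof (rule Bochner_Integration.integrable_bound)
  show "integrable lborel (\<lambda>y. real (N + 1) * (\<bar>y\<bar> ^ k * exp (- 1 * \<bar>y\<bar>)))"
    by (intro integrable_mult_right integrable_abs_power_exp_abs) simp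
  show "AE y in lborel. norm (\<bar>y\<bar> ^ k * \<bar>exp_exp_remainder N y\<bar>)
      \<le> norm (real (N + 1) * (\<bar>y\<bar> ^ k * exp (- 1 * \<bar>y\<bar>)))"
  proof (intro AE_I2)
    fix y
    have "\<bar>y\<bar> ^ k * \<bar>exp_exp_remainder N y\<bar> \<le> \<bar>y\<bar> ^ k * (real (N + 1) * exp (- \<bar>y\<bar>))"
      by (intro mult_left_mono abs_exp_exp_remainder_le) simp
    then show "norm (\<bar>y\<bar> ^ k * \<bar>exp_exp_remainder N y\<bar>) \<le> norm (real (N + 1) * (\<bar>y\<bar> ^ k * exp (- 1 * \<bar>y\<bar>)))"
      by (simp add: mult_ac)
  qed
qed simp

section \<open>Integration by parts across the jump at 0\<close>

lemma has_field_derivative_indicator_atMost_0: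
  fixes y :: real
  assumes "y \<noteq> 0"
  shows "((indicator {..0} :: real \<Rightarrow> real) has_field_derivative 0) (at y)"
proof (cases "y < 0")
  case True
  then show ?thesis
    by - (rule has_field_derivative_transform_within_open[where f = "\<lambda>_. 1" and S = "{..<0}", OF DERIV_const], auto)
next
  case False
  then show ?thesis
    using assms by - (rule has_field_derivative_transform_within_open[where f = "\<lambda>_. 0" and S = "{0<..}", OF DERIV_const], auto)
qed

text \<open>\<open>F\<close> has to be continuous at 0 but not differentiable there; the two
  boundary terms \<open>F 0\<close> cancel.\<close>

lemma integral_eq_FTC_split_0:
  fixes F f :: "real \<Rightarrow> real"
  assumes deriv: "\<And>x. x \<noteq> 0 \<Longrightarrow> (F has_field_derivative f x) (at x)"
    and cont: "\<And>x. x \<noteq> 0 \<Longrightarrow> isCont f x"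
    and int: "integrable lborel f"
    and lim: "(F \<longlongrightarrow> A) at_bot" "(F \<longlongrightarrow> F 0) (at 0)" "(F \<longlongrightarrow> B) at_top"
  shows "integral\<^sup>L lborel f = B - A"
proof -
  have int': "integrable lborel (\<lambda>x. indicator {..0} x *\<^sub>R f x)" "integrable lborel (\<lambda>x. indicator {0<..} x *\<^sub>R f x)"
    by (intro integrable_mult_indicator int; simp)+
  have "integral\<^sup>L lborel f = (\<integral>x. indicator {..0} x *\<^sub>R f x + indicator {0<..} x *\<^sub>R f x \<partial>lborel)"
    by (intro Bochner_Integration.integral_cong refl) (simp split: split_indicator)
  also have "\<dots> = (\<integral>x. indicator {..0} x *\<^sub>R f x \<partial>lborel) + (\<integral>x. indicator {0<..} x *\<^sub>R f x \<partial>lborel)"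
    using int' by (rule Bochner_Integration.integral_add)
  also have "(\<integral>x. indicator {..0} x *\<^sub>R f x \<partial>lborel) = F 0 - A"
    by (rule integral_FTC_atMost_0[where F = F])
       (use assms int' in \<open>auto simp: has_real_derivative_iff_has_vector_derivative filterlim_at_split\<close>)
  also have "(\<integral>x. indicator {0<..} x *\<^sub>R f x \<partial>lborel) = B - F 0"
    by (rule integral_FTC_greaterThan_0[where F = F])
       (use assms int' in \<open>auto simp: has_real_derivative_iff_has_vector_derivative filterlim_at_split\<close>)
  finally show ?thesis by simp
qed

text \<open>
  Integration by parts against \<open>y ^ Suc m\<close>: the boundary terms at the jump of the remainder vanish
  because \<open>y ^ Suc m\<close> does, and the derivative of \<open>exp (- exp y)\<close> produces the derivative of
  the Gamma function at 1.
\<close>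

lemma integral_power_exp_exp_remainder:
  "(\<integral>y. y ^ m * exp_exp_remainder N y \<partial>lborel) = fact m * a_coeff N m"
proof -
  let ?R = "exp_exp_remainder N"
  define I where "I = (\<integral>y. y ^ m * ?R y \<partial>lborel)"
  define G :: real where "G = (deriv ^^ Suc m) Gamma 1"
  \<comment> \<open>The integral of \<open>y ^ Suc m * exp (n * y)\<close> over the negative half
    line.\<close>
  define V :: "nat \<Rightarrow> real" where "V n = (- 1) ^ Suc m * fact (Suc m) / real n ^ (Suc m + 1)" for n
  define D where "D y = - (exp y * exp (- exp y))
      - indicator {..0} y * (\<Sum>n = 0..N. (- 1) ^ n / fact n * (real n * exp (real n * y)))" for y :: real
  define F where "F y = y ^ Suc m * ?R y" for y
  define f where "f y = real (Suc m) * (y ^ m * ?R y) + y ^ Suc m * D y" for y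
  have dR: "(?R has_field_derivative D y) (at y)" if "y \<noteq> 0" for y
  proof -
    have t: "((\<lambda>y. (- 1) ^ n / fact n * exp (real n * y)) has_field_derivative
        (- 1) ^ n / fact n * (real n * exp (real n * y))) (at y)" for n
      by (auto intro!: derivative_eq_intros)
    show ?thesis
      unfolding exp_exp_remainder_def[abs_def] D_def
      by (rule DERIV_cong[OF DERIV_diff[OF has_field_derivative_exp_neg_exp
            DERIV_mult[OF has_field_derivative_indicator_atMost_0[OF that] DERIV_sum[OF t]]]]) simp
  qed
  have dF: "(F has_field_derivative f y) (at y)" if "y \<noteq> 0" for y
    unfolding F_def[abs_def] f_def
    by (rule DERIV_cong[OF DERIV_mult[OF DERIV_pow dR[OF that]]]) (simp add: algebra_simps)
  have cf: "isCont f y" if "y \<noteq> 0" for y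
  proof -
    note [continuous_intros] = DERIV_isCont[OF dR[OF that]]
      DERIV_isCont[OF has_field_derivative_indicator_atMost_0[OF that]]
    show ?thesis
      unfolding f_def[abs_def] D_def by (intro continuous_intros)
  qed
  have boundF: "norm (F y) \<le> real (N + 1) * (\<bar>y\<bar> ^ Suc m * exp (- \<bar>y\<bar>))" for y
    using mult_left_mono[OF abs_exp_exp_remainder_le[of N y], of "\<bar>y\<bar> ^ Suc m"]
    \<comment> \<open>This bound tends to 0 at both infinities and at 0, and so yields all three
      limits of \<open>F\<close>.\<close>
    by (simp add: F_def abs_mult power_abs mult_ac)
  have bound0: "((\<lambda>y. real (N + 1) * (\<bar>y\<bar> ^ Suc m * exp (- \<bar>y\<bar>))) \<longlongrightarrow> 0) at_top"
    using tendsto_mult_right_zero[OF tendsto_power_div_exp_0[of "Suc m"], of "real (N + 1)"]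
    by (rule Lim_transform_eventually)
       (auto intro!: eventually_mono[OF eventually_ge_at_top[of 0]] simp: exp_minus divide_inverse)
  have hbi: "has_bochner_integral lborel f (real (Suc m) * I - G - (\<Sum>n = 1..N. (- 1) ^ n / fact n * real n * V n))"
  proof -
    have "integrable lborel (\<lambda>y. y ^ m * ?R y)"
      by (rule Bochner_Integration.integrable_bound[OF integrable_power_exp_exp_remainder[of m N]])
         (auto simp: abs_mult power_abs)
    then have 1: "has_bochner_integral lborel (\<lambda>y. real (Suc m) * (y ^ m * ?R y)) (real (Suc m) * I)"
      unfolding I_def by (intro has_bochner_integral_mult_right has_bochner_integral_integrable)
    have 2: "has_bochner_integral lborel (\<lambda>y. y ^ Suc m * (exp (1 * y) * exp (- exp y))) G"
      unfolding G_def higher_deriv_Gamma_real[OF zero_less_one]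
      by (intro has_bochner_integral_integrable integrable_power_exp_exp) simp
    have 3: "has_bochner_integral lborel
        (\<lambda>y. \<Sum>n = 1..N. (- 1) ^ n / fact n * real n * (indicator {..0} y * (y ^ Suc m * exp (real n * y))))
        (\<Sum>n = 1..N. (- 1) ^ n / fact n * real n * V n)"
      unfolding V_def
      by (intro has_bochner_integral_sum has_bochner_integral_mult_right has_bochner_integral_power_exp_atMost) auto
    have "f y = real (Suc m) * (y ^ m * ?R y) - y ^ Suc m * (exp (1 * y) * exp (- exp y))
        - (\<Sum>n = 1..N. (- 1) ^ n / fact n * real n * (indicator {..0} y * (y ^ Suc m * exp (real n * y))))" for y
    proof -
      \<comment> \<open>The term \<open>n = 0\<close> drops out because differentiation produced the
        factor \<open>n\<close>.\<close>
      have "y ^ Suc m * (indicator {..0} y * (\<Sum>n = 0..N. (- 1) ^ n / fact n * (real n * exp (real n * y))))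
          = (\<Sum>n = 1..N. (- 1) ^ n / fact n * real n * (indicator {..0} y * (y ^ Suc m * exp (real n * y))))"
        unfolding sum_distrib_left by (subst sum.atLeast_Suc_atMost) (auto intro!: sum.cong)
      then show ?thesis
        by (simp add: f_def D_def right_diff_distrib)
    qed
    then show ?thesis
      using has_bochner_integral_diff[OF has_bochner_integral_diff[OF 1 2] 3] by presburger
  qed
  have "integral\<^sup>L lborel f = 0 - 0"
  proof (rule integral_eq_FTC_split_0[of F f, OF dF cf])
    show "integrable lborel f" using hbi by (simp add: has_bochner_integral_iff)
    show "(F \<longlongrightarrow> 0) at_top"
      by (rule tendsto_norm_zero_cancel, rule tendsto_sandwich[OF _ _ tendsto_const bound0])
         (use boundF in auto)
    show "(F \<longlongrightarrow> 0) at_bot"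
      unfolding filterlim_at_bot_mirror
      by (rule tendsto_norm_zero_cancel, rule tendsto_sandwich[OF _ _ tendsto_const bound0])
         (use boundF[of "- _"] in auto)
    have "((\<lambda>y. real (N + 1) * (\<bar>y\<bar> ^ Suc m * exp (- \<bar>y\<bar>))) \<longlongrightarrow> real (N + 1) * (\<bar>0\<bar> ^ Suc m * exp (- \<bar>0\<bar>))) (at 0)"
      by (intro tendsto_intros)
    then have lim0: "((\<lambda>y. real (N + 1) * (\<bar>y\<bar> ^ Suc m * exp (- \<bar>y\<bar>))) \<longlongrightarrow> 0) (at 0)"
      by simp
    have "(F \<longlongrightarrow> 0) (at 0)"
      by (rule tendsto_norm_zero_cancel, rule tendsto_sandwich[OF _ _ tendsto_const lim0])
         (use boundF in auto)
    then show "(F \<longlongrightarrow> F 0) (at 0)" by (simp add: F_def)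
  qed
  \<comment> \<open>All boundary values vanish, so \<open>f\<close> has integral 0 and its termwise
    value can be solved for \<open>I\<close>.\<close>
  then have "real (Suc m) * I = G + (\<Sum>n = 1..N. (- 1) ^ n / fact n * real n * V n)"
    using hbi by (simp add: has_bochner_integral_iff)
  also have "(\<Sum>n = 1..N. (- 1) ^ n / fact n * real n * V n)
      = (- 1) ^ Suc m * fact (Suc m) * (\<Sum>n = 1..N. (- 1) ^ n / fact n * (1 / real n ^ Suc m))"
    unfolding sum_distrib_left V_def by (intro sum.cong refl) (simp add: divide_simps)
  also have "G + \<dots> = fact (Suc m) * a_coeff N m"
    unfolding a_coeff_def G_def Suc_eq_plus1[symmetric]
    by (simp add: distrib_left del: fact_Suc power_Suc funpow.simps)
  finally have "real (Suc m) * I = real (Suc m) * (fact m * a_coeff N m)"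
    by (simp add: mult.assoc)
  then show ?thesis unfolding I_def by (subst (asm) mult_cancel_left) simp
qed

subsection \<open>Taylor expansion of the Gaussian\<close>

text \<open>Cauchy's estimate on the unit circle around \<open>x\<close>: the circle stays in the
  strip where the imaginary part is at most 2 in modulus, and there the Gaussian is at most
  \<open>exp 2\<close>.\<close>

lemma norm_higher_deriv_gaussian_le:
  fixes x :: complex
  assumes "\<bar>Im x\<bar> \<le> 1"
  shows "norm ((deriv ^^ k) (\<lambda>t. exp (- t\<^sup>2 / 2)) x) \<le> fact k * exp 2"
proof -
  have "norm ((deriv ^^ k) (\<lambda>t. exp (- t\<^sup>2 / 2)) x) \<le> fact k * exp 2 / 1 ^ k"
  proof (rule Cauchy_inequality)
    fix v assume "norm (x - v) = 1"
    then have "\<bar>Im v\<bar> \<le> 2"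
      using assms abs_Im_le_cmod[of "x - v"] by simp
    then have "(Im v)\<^sup>2 \<le> 4"
      using power_mono[of "\<bar>Im v\<bar>" 2 2] by simp
    then have "((Im v)\<^sup>2 - (Re v)\<^sup>2) / 2 \<le> (4 - 0) / 2"
      by (intro divide_right_mono diff_mono) auto
    also have "((Im v)\<^sup>2 - (Re v)\<^sup>2) / 2 = Re (- v\<^sup>2 / 2)"
      by (simp add: power2_eq_square field_simps)
    finally have "Re (- v\<^sup>2 / 2) \<le> 2" by simp
    then show "norm (exp (- v\<^sup>2 / 2)) \<le> exp 2"
      unfolding norm_exp_eq_Re by simp
  qed (auto intro!: holomorphic_intros continuous_intros)
  then show ?thesis by simp
qed

text \<open>Taylor expansion at \<open>- l\<close> with real increment \<open>t\<close>. Both end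
  points lie in the strip of imaginary part at most 1 in modulus, which is convex, so the derivative
  bound makes the constant independent of \<open>t\<close> and \<open>l\<close>.\<close>

lemma gaussian_Taylor_bound:
  fixes l :: complex and t :: real
  assumes "norm l \<le> 1"
  shows "norm (exp (- (of_real t - l)\<^sup>2 / 2)
           - (\<Sum>i\<le>n. (deriv ^^ i) (\<lambda>t. exp (- t\<^sup>2 / 2)) (- l) * of_real t ^ i / fact i))
         \<le> real (Suc n) * exp 2 * \<bar>t\<bar> ^ Suc n"
proof -
  let ?G = "\<lambda>t::complex. exp (- t\<^sup>2 / 2)"
  let ?S = "{z. Im z \<le> 1} \<inter> {z. Im z \<ge> - 1}"
  have l: "\<bar>Im l\<bar> \<le> 1" using assms abs_Im_le_cmod[of l] by simp
  \<comment> \<open>The remainder is divided by \<open>fact n\<close> while the derivative bound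
    carries \<open>fact (Suc n)\<close>; hence the factor \<open>Suc n\<close>.\<close>
  have "norm ((deriv ^^ 0) ?G (of_real t - l)
           - (\<Sum>i\<le>n. (deriv ^^ i) ?G (- l) * (of_real t - l - (- l)) ^ i / fact i))
        \<le> fact (Suc n) * exp 2 * norm (of_real t - l - (- l)) ^ Suc n / fact n"
  proof (rule complex_Taylor[where S = ?S])
    show "convex ?S"
      by (intro convex_Int convex_halfspace_Im_le convex_halfspace_Im_ge)
    show "((deriv ^^ i) ?G has_field_derivative (deriv ^^ Suc i) ?G x) (at x within ?S)" for i x
      unfolding funpow.simps o_def
      by (rule holomorphic_derivI[where S = UNIV])
         (auto intro!: holomorphic_higher_deriv holomorphic_intros)
    show "norm ((deriv ^^ Suc n) ?G x) \<le> fact (Suc n) * exp 2" if "x \<in> ?S" for x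
      using that by (intro norm_higher_deriv_gaussian_le) auto
  qed (use l in auto)
  then show ?thesis by (simp add: mult_ac)
qed

lemma gauss_kernel_eq: "gauss_kernel \<sigma> w y = exp (- (of_real (y / \<sigma>) - w / of_real \<sigma>)\<^sup>2 / 2)"
  by (simp add: gauss_kernel_def power_divide mult.commute flip: diff_divide_distrib)

text \<open>The Taylor estimate in \<open>y / \<sigma>\<close> is integrated against the remainder;
  the moments \<open>fact m * a_coeff N m\<close> cancel the Taylor factorials. The condition
  \<open>norm w \<le> \<sigma>\<close> puts \<open>w / \<sigma>\<close> in the unit disc.\<close>

lemma integral_remainder_gauss_kernel_bound:
  assumes "\<sigma> > 0" "norm w \<le> \<sigma>"
  shows "norm ((\<integral>y. exp_exp_remainder N y *\<^sub>R gauss_kernel \<sigma> w y \<partial>lborel)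
           - (\<Sum>m\<le>M. (deriv ^^ m) (\<lambda>t. exp (- t\<^sup>2 / 2)) (- w / of_real \<sigma>) * of_real (a_coeff N m / \<sigma> ^ m)))
         \<le> real (Suc M) * exp 2 * (\<integral>y. \<bar>y\<bar> ^ Suc M * \<bar>exp_exp_remainder N y\<bar> \<partial>lborel) / \<sigma> ^ Suc M"
proof -
  let ?R = "exp_exp_remainder N"
  define d where "d m = (deriv ^^ m) (\<lambda>t. exp (- t\<^sup>2 / 2)) (- w / of_real \<sigma>)" for m
  have iR: "integrable lborel (\<lambda>y. y ^ m * ?R y)" for m
    by (rule Bochner_Integration.integrable_bound[OF integrable_power_exp_exp_remainder[of m N]])
       (auto simp: abs_mult power_abs)
  have T: "has_bochner_integral lborel (\<lambda>y. \<Sum>m\<le>M. d m / fact m * of_real (1 / \<sigma> ^ m) * of_real (y ^ m * ?R y))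
      (\<Sum>m\<le>M. d m / fact m * of_real (1 / \<sigma> ^ m) * of_real (fact m * a_coeff N m))"
    unfolding integral_power_exp_exp_remainder[symmetric]
    by (intro has_bochner_integral_sum has_bochner_integral_mult_right has_bochner_integral_of_real
        has_bochner_integral_integrable iR)
  have eq: "(\<Sum>m\<le>M. d m / fact m * of_real (1 / \<sigma> ^ m) * of_real (y ^ m * ?R y))
      = ?R y *\<^sub>R (\<Sum>m\<le>M. d m * of_real (y / \<sigma>) ^ m / fact m)" for y
    unfolding scaleR_conv_of_real sum_distrib_left
    by (intro sum.cong refl) (simp add: power_divide mult_ac)
  have bound: "norm (?R y *\<^sub>R gauss_kernel \<sigma> w y - ?R y *\<^sub>R (\<Sum>m\<le>M. d m * of_real (y / \<sigma>) ^ m / fact m))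
      \<le> real (Suc M) * exp 2 / \<sigma> ^ Suc M * (\<bar>y\<bar> ^ Suc M * \<bar>?R y\<bar>)" for y
  proof -
    have "norm (w / of_real \<sigma>) \<le> 1"
      using assms by (simp add: norm_divide divide_le_eq)
    from gaussian_Taylor_bound[OF this, of "y / \<sigma>" M]
    have "norm (gauss_kernel \<sigma> w y - (\<Sum>m\<le>M. d m * of_real (y / \<sigma>) ^ m / fact m))
        \<le> real (Suc M) * exp 2 * \<bar>y / \<sigma>\<bar> ^ Suc M"
      unfolding gauss_kernel_eq d_def minus_divide_left .
    from mult_left_mono[OF this, of "\<bar>?R y\<bar>"] show ?thesis
      using assms(1) unfolding scaleR_diff_right[symmetric] norm_scaleR
      by (simp add: power_divide mult_ac)
  qed
  have meas: "(\<lambda>y. ?R y *\<^sub>R gauss_kernel \<sigma> w y) \<in> borel_measurable lborel" by simp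
  \<comment> \<open>The difference is integrable by the pointwise bound; adding the polynomial part
    then gives integrability of the kernel term.\<close>
  have iE: "integrable lborel (\<lambda>y. ?R y *\<^sub>R gauss_kernel \<sigma> w y - ?R y *\<^sub>R (\<Sum>m\<le>M. d m * of_real (y / \<sigma>) ^ m / fact m))"
  proof (rule Bochner_Integration.integrable_bound)
    show "integrable lborel (\<lambda>y. real (Suc M) * exp 2 / \<sigma> ^ Suc M * (\<bar>y\<bar> ^ Suc M * \<bar>?R y\<bar>))"
      by (intro integrable_mult_right integrable_power_exp_exp_remainder)
    show "AE y in lborel. norm (?R y *\<^sub>R gauss_kernel \<sigma> w y - ?R y *\<^sub>R (\<Sum>m\<le>M. d m * of_real (y / \<sigma>) ^ m / fact m))
        \<le> norm (real (Suc M) * exp 2 / \<sigma> ^ Suc M * (\<bar>y\<bar> ^ Suc M * \<bar>?R y\<bar>))"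
      by (intro AE_I2 order_trans[OF bound]) (simp only: real_norm_def abs_ge_self)
  qed (use meas in measurable)
  have "(\<integral>y. ?R y *\<^sub>R gauss_kernel \<sigma> w y \<partial>lborel)
      - (\<Sum>m\<le>M. d m / fact m * of_real (1 / \<sigma> ^ m) * of_real (fact m * a_coeff N m))
      = (\<integral>y. ?R y *\<^sub>R gauss_kernel \<sigma> w y - ?R y *\<^sub>R (\<Sum>m\<le>M. d m * of_real (y / \<sigma>) ^ m / fact m) \<partial>lborel)"
  proof -
    note T' = T[unfolded eq has_bochner_integral_iff]
    have "integrable lborel (\<lambda>y. ?R y *\<^sub>R gauss_kernel \<sigma> w y)"
      using Bochner_Integration.integrable_add[OF iE conjunct1[OF T']] by simp
    then show ?thesis
      using T' by (subst Bochner_Integration.integral_diff) auto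
  qed
  also have "norm \<dots> \<le> (\<integral>y. real (Suc M) * exp 2 / \<sigma> ^ Suc M * (\<bar>y\<bar> ^ Suc M * \<bar>?R y\<bar>) \<partial>lborel)"
    by (rule Bochner_Integration.integral_norm_bound_integral[OF iE _ bound])
       (intro integrable_mult_right integrable_power_exp_exp_remainder)
  also have "\<dots> = real (Suc M) * exp 2 * (\<integral>y. \<bar>y\<bar> ^ Suc M * \<bar>?R y\<bar> \<partial>lborel) / \<sigma> ^ Suc M"
    by simp
  also have "(\<Sum>m\<le>M. d m / fact m * of_real (1 / \<sigma> ^ m) * of_real (fact m * a_coeff N m))
      = (\<Sum>m\<le>M. d m * of_real (a_coeff N m / \<sigma> ^ m))"
    by (intro sum.cong refl) simp
  finally show ?thesis unfolding d_def .
qed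

subsection \<open>The Laplace transform as a Gaussian mean\<close>

lemma borel_measurable_lognormal_density [measurable]:
  "lognormal_density \<mu> \<sigma> \<in> borel_measurable borel"
  unfolding lognormal_density_def by measurable

lemma lognormal_density_nonneg: "\<sigma> > 0 \<Longrightarrow> 0 \<le> lognormal_density \<mu> \<sigma> x"
  by (simp add: lognormal_density_def)

lemma exp_mult_lognormal_density_exp:
  assumes "\<sigma> > 0"
  shows "exp y * lognormal_density \<mu> \<sigma> (exp y) = normal_density \<mu> \<sigma> y"
  using assms by (simp add: lognormal_density_def normal_density_def real_sqrt_mult)

text \<open>Passing to the law of \<open>X\<close> and substituting \<open>x = exp y\<close> turns
  the lognormal density, with the Jacobian, into the normal one.\<close>

lemma laplace_transform_lognormal:
  assumes "lognormal_distributed P X \<mu> \<sigma>" and s: "Re s > 0"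
  shows "laplace_transform P X s
       = (\<integral>y. normal_density \<mu> \<sigma> y *\<^sub>R exp (- s * of_real (exp y)) \<partial>lborel)"
proof -
  let ?d = "lognormal_density \<mu> \<sigma>" and ?e = "\<lambda>x. exp (- s * complex_of_real x)"
  from assms have \<sigma>: "\<sigma> > 0" and "prob_space P" and D: "distributed P lborel X (\<lambda>x. ennreal (?d x))"
    by (auto simp: lognormal_distributed_def)
  interpret prob_space P by fact
  have X [measurable]: "X \<in> borel_measurable P"
    using D by (simp add: distributed_def)
  have distr: "distr P lborel X = density lborel (\<lambda>x. ennreal (?d x))"
    using D by (simp add: distributed_def)
  \<comment> \<open>Integrability of the density is read off from the law of \<open>X\<close> being
    a probability measure.\<close>
  have "prob_space (density lborel (\<lambda>x. ennreal (?d x)))"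
    unfolding distr[symmetric] by (rule prob_space_distr) simp
  then have "integrable (density lborel (\<lambda>x. ennreal (?d x))) (\<lambda>x. 1 :: real)"
    by (simp add: prob_space.finite_measure finite_measure.integrable_const)
  then have "integrable lborel ?d"
    using \<sigma> by (subst (asm) integrable_density) (auto simp: lognormal_density_nonneg)
  then have int: "integrable lborel (\<lambda>x. ?d x *\<^sub>R ?e x)"
  proof (rule Bochner_Integration.integrable_bound)
    have "norm (?d x *\<^sub>R ?e x) \<le> norm (?d x)" for x
    proof (cases "x > 0")
      case True
      then have "norm (?e x) \<le> 1" using s by (simp add: norm_exp_eq_Re)
      then show ?thesis by (simp add: mult_left_le)
    qed (simp add: lognormal_density_def)
    then show "AE x in lborel. norm (?d x *\<^sub>R ?e x) \<le> norm (?d x)" by simp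
  qed simp
  have ind: "indicator {0<..} x *\<^sub>R (?d x *\<^sub>R ?e x) = ?d x *\<^sub>R ?e x" for x
    by (simp add: lognormal_density_def indicator_def)
  have "laplace_transform P X s = (\<integral>x. ?e x \<partial>distr P lborel X)"
    unfolding laplace_transform_def by (subst integral_distr) auto
  also have "\<dots> = (LBINT x:{0<..}. ?d x *\<^sub>R ?e x)"
    unfolding distr set_lebesgue_integral_def ind
    using \<sigma> by (subst integral_density) (auto simp: lognormal_density_nonneg)
  also have "\<dots> = (\<integral>y. exp y *\<^sub>R (?d (exp y) *\<^sub>R ?e (exp y)) \<partial>lborel)"
    by (rule integrable_lborel_exp_substitution(2)[symmetric]) (use int in \<open>simp only: set_integrable_def ind\<close>)
  finally show ?thesis
    by (simp add: exp_mult_lognormal_density_exp[OF \<sigma>])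
qed

text \<open>The derivative brings down \<open>exp y\<close>, which is unbounded. On the half plane
  \<open>Re x > Re s / 2\<close> the inequality \<open>u \<le> exp u\<close> with
  \<open>u = Re s / 2 * exp y\<close> bounds the product by \<open>2 / Re s\<close>.\<close>

lemma holomorphic_on_integral_normal_density_exp:
  assumes "\<sigma> > 0"
  shows "(\<lambda>s. \<integral>y. normal_density \<mu> \<sigma> y *\<^sub>R exp (- s * of_real (exp y)) \<partial>lborel)
           holomorphic_on {s. Re s > 0}"
proof (rule holomorphic_onI)
  fix s :: complex assume "s \<in> {s. Re s > 0}"
  then have a: "Re s / 2 > 0" "Re s > 0" by simp_all
  have bound: "exp y * norm (exp (- x * of_real (exp y))) \<le> 2 / Re s" if "Re x > Re s / 2" for x and y :: real
  proof -
    have "Re s / 2 * exp y \<le> exp (Re s / 2 * exp y)"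
      using exp_ge_add_one_self[of "Re s / 2 * exp y"] by linarith
    also have "\<dots> \<le> exp (Re x * exp y)"
      using that by simp
    finally have "exp y * exp (- (Re x * exp y)) \<le> 2 / Re s"
      using a by (simp add: exp_minus field_simps)
    moreover have "norm (exp (- x * of_real (exp y))) = exp (- (Re x * exp y))"
      by (simp add: norm_exp_eq_Re)
    ultimately show ?thesis by simp
  qed
  have "((\<lambda>s. \<integral>y. normal_density \<mu> \<sigma> y *\<^sub>R exp (- s * of_real (exp y)) \<partial>lborel) has_field_derivative
      (\<integral>y. normal_density \<mu> \<sigma> y *\<^sub>R (- of_real (exp y) * exp (- s * of_real (exp y))) \<partial>lborel)) (at s)"
  proof (rule has_field_derivative_lebesgue_integral[where S = "{x. Re x > Re s / 2}"
        and g = "\<lambda>y. normal_density \<mu> \<sigma> y * (2 / Re s)"])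
    show "integrable lborel (\<lambda>y. normal_density \<mu> \<sigma> y *\<^sub>R exp (- x * of_real (exp y)))"
      if "x \<in> {x. Re x > Re s / 2}" for x
    proof (rule Bochner_Integration.integrable_bound[OF integrable_normal_density[OF assms]])
      have "norm (exp (- x * of_real (exp y))) \<le> 1" for y :: real
        using that a by (simp add: norm_exp_eq_Re)
      then show "AE y in lborel. norm (normal_density \<mu> \<sigma> y *\<^sub>R exp (- x * of_real (exp y))) \<le> norm (normal_density \<mu> \<sigma> y)"
        by (intro AE_I2) (simp add: mult_left_le)
    qed simp
    show "((\<lambda>s. normal_density \<mu> \<sigma> y *\<^sub>R exp (- s * of_real (exp y))) has_field_derivative
        normal_density \<mu> \<sigma> y *\<^sub>R (- of_real (exp y) * exp (- x * of_real (exp y)))) (at x)" for x y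
      unfolding scaleR_conv_of_real by (auto intro!: derivative_eq_intros)
    show "norm (normal_density \<mu> \<sigma> y *\<^sub>R (- of_real (exp y) * exp (- x * of_real (exp y))))
        \<le> normal_density \<mu> \<sigma> y * (2 / Re s)" if "x \<in> {x. Re x > Re s / 2}" for x y
      using mult_left_mono[OF bound[of x y], of "normal_density \<mu> \<sigma> y"] that
      by (simp add: norm_mult)
    show "integrable lborel (\<lambda>y. normal_density \<mu> \<sigma> y * (2 / Re s))"
      by (intro integrable_mult_left integrable_normal_density assms)
    show "open {x. Re x > Re s / 2}" "convex {x. Re x > Re s / 2}"
      by (rule open_halfspace_Re_gt convex_halfspace_Re_gt)+
  qed (use a in auto)
  then show "(\<lambda>s. \<integral>y. normal_density \<mu> \<sigma> y *\<^sub>R exp (- s * of_real (exp y)) \<partial>lborel)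
      field_differentiable at s within {s. Re s > 0}"
    using field_differentiable_at_within field_differentiable_def by blast
qed

text \<open>The Gaussian mean \<open>K\<close> is entire in \<open>w\<close>, so
  \<open>K (\<mu> + ln s)\<close> is holomorphic on the slit plane. It equals the transform for
  positive \<open>s\<close>, hence on the right half plane by the identity theorem, and is therefore
  the continuation.\<close>

lemma laplace_continuation_lognormal:
  assumes "lognormal_distributed P X \<mu> \<sigma>" and z: "z \<notin> \<real>\<^sub>\<le>\<^sub>0"
  shows "laplace_continuation P X z
       = of_real (1 / (sqrt (2 * pi) * \<sigma>)) *
         (\<integral>y. exp (- exp y) *\<^sub>R gauss_kernel \<sigma> (of_real \<mu> + ln z) y \<partial>lborel)"
proof -
  have \<sigma>: "\<sigma> > 0" using assms by (simp add: lognormal_distributed_def)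
  define K where "K w = of_real (1 / (sqrt (2 * pi) * \<sigma>)) *
    (\<integral>y. exp (- exp y) *\<^sub>R gauss_kernel \<sigma> w y \<partial>lborel)" for w
  define A where "A s = (\<integral>y. normal_density \<mu> \<sigma> y *\<^sub>R exp (- s * complex_of_real (exp y)) \<partial>lborel)" for s
  have "\<exists>D. (K has_field_derivative D) (at w)" for w
    unfolding K_def[abs_def]
    by (rule exI, rule DERIV_cmult, rule has_field_derivative_integral_gauss_kernel[OF \<sigma>]) simp_all
  then have "K holomorphic_on UNIV"
    by (simp add: holomorphic_on_def field_differentiable_def)
  then have holK: "(\<lambda>s. K (of_real \<mu> + ln s)) holomorphic_on - \<real>\<^sub>\<le>\<^sub>0"
    by (intro holomorphic_on_compose_gen[of "\<lambda>s. of_real \<mu> + ln s" _ K UNIV, unfolded o_def] holomorphic_intros) auto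
  have sub: "{s. Re s > 0} \<subseteq> - \<real>\<^sub>\<le>\<^sub>0" by (auto simp: complex_nonpos_Reals_iff)
  have real: "A (of_real r) = K (of_real \<mu> + ln (of_real r))" if r: "r > 0" for r :: real
  proof -
    \<comment> \<open>Translating \<open>y\<close> by \<open>- ln r\<close> removes \<open>r\<close>
      from the inner exponential and adds \<open>ln r\<close> to the mean.\<close>
    have "A (of_real r) = (\<integral>y. normal_density \<mu> \<sigma> (- ln r + 1 * y) *\<^sub>R
        exp (- of_real r * complex_of_real (exp (- ln r + 1 * y))) \<partial>lborel)"
      unfolding A_def by (subst lborel_integral_real_affine[of 1 _ "- ln r"]) simp_all
    also have "\<dots> = (\<integral>y. of_real (1 / (sqrt (2 * pi) * \<sigma>)) *
        (exp (- exp y) *\<^sub>R gauss_kernel \<sigma> (of_real \<mu> + ln (of_real r)) y) \<partial>lborel)"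
    proof (intro Bochner_Integration.integral_cong refl)
      fix y :: real
      have e: "r * exp (- ln r + 1 * y) = exp y"
        using r by (simp add: exp_diff)
      have k: "gauss_kernel \<sigma> (of_real \<mu> + ln (of_real r)) y
          = of_real (exp (- (- ln r + 1 * y - \<mu>)\<^sup>2 / (2 * \<sigma>\<^sup>2)))"
        using r by (simp add: gauss_kernel_def Ln_of_real exp_of_real[symmetric] algebra_simps)
      have "exp (- of_real r * complex_of_real (exp (- ln r + 1 * y))) = of_real (exp (- exp y))"
        unfolding e[symmetric] by (simp add: exp_of_real[symmetric])
      then show "normal_density \<mu> \<sigma> (- ln r + 1 * y) *\<^sub>R exp (- of_real r * complex_of_real (exp (- ln r + 1 * y)))
          = of_real (1 / (sqrt (2 * pi) * \<sigma>)) * (exp (- exp y) *\<^sub>R gauss_kernel \<sigma> (of_real \<mu> + ln (of_real r)) y)"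
        using \<sigma> unfolding k normal_density_def
        by (simp add: scaleR_conv_of_real real_sqrt_mult)
    qed
    finally show ?thesis unfolding K_def integral_mult_right_zero .
  qed
  have eq: "A s = K (of_real \<mu> + ln s)" if s: "Re s > 0" for s
  proof -
    have "A s - K (of_real \<mu> + ln s) = 0"
    proof (rule analytic_continuation[of "\<lambda>s. A s - K (of_real \<mu> + ln s)" "{s. Re s > 0}" "complex_of_real ` {0<..}" 1])
      show "(\<lambda>s. A s - K (of_real \<mu> + ln s)) holomorphic_on {s. Re s > 0}"
        using holomorphic_on_integral_normal_density_exp[OF \<sigma>, of \<mu>] holomorphic_on_subset[OF holK sub]
        unfolding A_def by (intro holomorphic_on_diff)
      show "1 islimpt complex_of_real ` {0<..}"
        unfolding islimpt_sequential
      proof (intro exI[of _ "\<lambda>n. complex_of_real (1 + 1 / real (Suc n))"] conjI allI)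
        show "complex_of_real (1 + 1 / real (Suc n)) \<in> complex_of_real ` {0<..} - {1}" for n
          using of_real_eq_1_iff[of "1 + 1 / real (Suc n)"] by (auto simp: add_pos_pos simp del: of_real_add)
        have "(\<lambda>n. complex_of_real (1 + 1 / real (Suc n))) \<longlonglongrightarrow> of_real (1 + 0)"
          by (intro tendsto_intros LIMSEQ_Suc[OF lim_1_over_n])
        then show "(\<lambda>n. complex_of_real (1 + 1 / real (Suc n))) \<longlonglongrightarrow> 1" by simp
      qed
    qed (use s real in \<open>auto simp: open_halfspace_Re_gt intro!: convex_connected convex_halfspace_Re_gt\<close>)
    then show ?thesis by simp
  qed
  have "is_laplace_continuation P X (\<lambda>s. K (of_real \<mu> + ln s))"
    unfolding is_laplace_continuation_def
    using holK eq laplace_transform_lognormal[OF assms(1)] by (auto simp: A_def)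
  from laplace_continuation_eq[OF this z] show ?thesis
    by (simp add: K_def)
qed

subsection \<open>The expansion\<close>

text \<open>The terms subtracted in the remainder are added back, each contributing its
  \<open>erfc\<close> integral. The identity is exact.\<close>

lemma integral_exp_exp_gauss_kernel:
  assumes "\<sigma> > 0"
  shows "(\<integral>y. exp (- exp y) *\<^sub>R gauss_kernel \<sigma> w y \<partial>lborel)
       = of_real (sqrt (2 * pi) * \<sigma>) * (\<Sum>n = 0..N. (- 1) ^ n / fact n *
           (exp (of_nat n * w + of_real (\<sigma>\<^sup>2 / 2 * (real n)\<^sup>2)) *
            (1 / 2 * erfc ((w + of_real (\<sigma>\<^sup>2 * real n)) / of_real (sqrt 2 * \<sigma>)))))
         + (\<integral>y. exp_exp_remainder N y *\<^sub>R gauss_kernel \<sigma> w y \<partial>lborel)"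
proof -
  let ?E = "gauss_kernel \<sigma> w"
  let ?t = "\<lambda>n y. indicator {..0} y *\<^sub>R (exp (real n * y) *\<^sub>R ?E y)"
  let ?L = "\<lambda>y. \<Sum>n = 0..N. (- 1) ^ n / fact n * ?t n y"
  have L: "has_bochner_integral lborel ?L (\<Sum>n = 0..N. (- 1) ^ n / fact n * integral\<^sup>L lborel (?t n))"
    by (intro has_bochner_integral_sum has_bochner_integral_mult_right has_bochner_integral_integrable
        integral_exp_gauss_kernel_atMost_0 assms)
  have E: "integrable lborel (\<lambda>y. exp (- exp y) *\<^sub>R ?E y)"
    by (rule integrable_gauss_kernel[OF assms]) simp_all
  have "?L y = (indicator {..0} y * (\<Sum>n = 0..N. (- 1) ^ n / fact n * exp (real n * y))) *\<^sub>R ?E y" for y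
    by (simp add: scaleR_conv_of_real sum_distrib_left sum_distrib_right mult_ac)
  then have "exp_exp_remainder N y *\<^sub>R ?E y = exp (- exp y) *\<^sub>R ?E y - ?L y" for y
    unfolding exp_exp_remainder_def scaleR_left_diff_distrib by presburger
  then have "(\<integral>y. exp_exp_remainder N y *\<^sub>R ?E y \<partial>lborel)
      = (\<integral>y. exp (- exp y) *\<^sub>R ?E y \<partial>lborel) - (\<Sum>n = 0..N. (- 1) ^ n / fact n * integral\<^sup>L lborel (?t n))"
    using E L by (simp add: has_bochner_integral_iff)
  then show ?thesis
    unfolding integral_exp_gauss_kernel_atMost_0(1)[OF assms] sum_distrib_left
    by (simp add: mult_ac)
qed

theorem theorem4:
  fixes \<mu> :: real and M N :: nat and z :: complex
    and P :: "real \<Rightarrow> 'a measure" and X :: "real \<Rightarrow> 'a \<Rightarrow> real"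
  assumes "M \<ge> 1" and "N \<ge> 1"
    and "z \<notin> \<real>\<^sub>\<le>\<^sub>0"
    and "\<And>\<sigma>. \<sigma> > 0 \<Longrightarrow> lognormal_distributed (P \<sigma>) (X \<sigma>) \<mu> \<sigma>"
  shows "(\<lambda>\<sigma>. laplace_continuation (P \<sigma>) (X \<sigma>) z
            - ((\<Sum>n = 0..N. (- z) ^ n / fact n
                  * of_real (exp (\<mu> * real n + \<sigma>\<^sup>2 / 2 * (real n)\<^sup>2))
                  * (1 / 2 * erfc ((of_real \<mu> + ln z + of_real (\<sigma>\<^sup>2 * real n))
                                    / of_real (sqrt 2 * \<sigma>))))
             + (\<Sum>m = 0..M. of_real ((- 1) ^ m * a_coeff N m / (sqrt (2 * pi) * \<sigma> ^ (m + 1)))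
                  * exp (- (of_real \<mu> + ln z)\<^sup>2 / of_real (2 * \<sigma>\<^sup>2))
                  * hermite m (- (of_real \<mu> + ln z) / of_real \<sigma>))))
         \<in> O[at_top](\<lambda>\<sigma>. of_real (1 / \<sigma> ^ (M + 2)))"
proof -
  define L where "L = of_real \<mu> + ln z"
  \<comment> \<open>The Taylor error constant with the normalisation \<open>sqrt (2 * pi)\<close>
    divided out; it is free of \<open>\<sigma>\<close>.\<close>
  define C where "C = real (Suc M) * exp 2 * (\<integral>y. \<bar>y\<bar> ^ Suc M * \<bar>exp_exp_remainder N y\<bar> \<partial>lborel) / sqrt (2 * pi)"
  define I where "I \<sigma> = (\<integral>y. exp_exp_remainder N y *\<^sub>R gauss_kernel \<sigma> L y \<partial>lborel)" for \<sigma>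
  define S where "S \<sigma> = (\<Sum>m\<le>M. (deriv ^^ m) (\<lambda>t. exp (- t\<^sup>2 / 2)) (- L / of_real \<sigma>)
      * of_real (a_coeff N m / \<sigma> ^ m))" for \<sigma>
  have z: "z \<noteq> 0" using assms(3) by auto
  have main: "(\<Sum>n = 0..N. (- z) ^ n / fact n * of_real (exp (\<mu> * real n + \<sigma>\<^sup>2 / 2 * (real n)\<^sup>2))
        * (1 / 2 * erfc ((L + of_real (\<sigma>\<^sup>2 * real n)) / of_real (sqrt 2 * \<sigma>))))
      = (\<Sum>n = 0..N. (- 1) ^ n / fact n * (exp (of_nat n * L + of_real (\<sigma>\<^sup>2 / 2 * (real n)\<^sup>2)) *
            (1 / 2 * erfc ((L + of_real (\<sigma>\<^sup>2 * real n)) / of_real (sqrt 2 * \<sigma>)))))" for \<sigma>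
  proof (intro sum.cong refl)
    fix n
    have "exp (of_nat n * L + of_real (\<sigma>\<^sup>2 / 2 * (real n)\<^sup>2))
        = exp (of_nat n * ln z) * exp (of_real (\<mu> * real n + \<sigma>\<^sup>2 / 2 * (real n)\<^sup>2))"
      unfolding exp_add[symmetric] by (simp add: L_def algebra_simps)
    also have "exp (of_nat n * ln z) = z ^ n"
      using z by (simp add: exp_of_nat_mult)
    finally have "exp (of_nat n * L + of_real (\<sigma>\<^sup>2 / 2 * (real n)\<^sup>2))
        = z ^ n * of_real (exp (\<mu> * real n + \<sigma>\<^sup>2 / 2 * (real n)\<^sup>2))"
      unfolding exp_of_real .
    then show "(- z) ^ n / fact n * of_real (exp (\<mu> * real n + \<sigma>\<^sup>2 / 2 * (real n)\<^sup>2))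
        * (1 / 2 * erfc ((L + of_real (\<sigma>\<^sup>2 * real n)) / of_real (sqrt 2 * \<sigma>)))
      = (- 1) ^ n / fact n * (exp (of_nat n * L + of_real (\<sigma>\<^sup>2 / 2 * (real n)\<^sup>2)) *
            (1 / 2 * erfc ((L + of_real (\<sigma>\<^sup>2 * real n)) / of_real (sqrt 2 * \<sigma>))))"
      unfolding power_minus[of z n] by (simp only: mult_ac times_divide_eq_left times_divide_eq_right divide_divide_eq_left)
  qed
  have hermite: "(\<Sum>m = 0..M. of_real ((- 1) ^ m * a_coeff N m / (sqrt (2 * pi) * \<sigma> ^ (m + 1)))
        * exp (- L\<^sup>2 / of_real (2 * \<sigma>\<^sup>2)) * hermite m (- L / of_real \<sigma>))
      = of_real (1 / (sqrt (2 * pi) * \<sigma>)) * S \<sigma>" for \<sigma>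
    unfolding S_def sum_distrib_left atMost_atLeast0
  proof (intro sum.cong refl)
    fix m
    let ?d = "(deriv ^^ m) (\<lambda>t::complex. exp (- t\<^sup>2 / 2)) (- L / of_real \<sigma>)"
    let ?e = "exp (- L\<^sup>2 / of_real (2 * \<sigma>\<^sup>2))" and ?e' = "exp ((- L / of_real \<sigma>)\<^sup>2 / 2)"
    \<comment> \<open>The Gaussian prefactor cancels the exponential in the Rodrigues formula; the
      two signs \<open>(- 1) ^ m\<close> cancel below, leaving a plain Taylor coefficient.\<close>
    have inv: "?e * ?e' = 1"
      unfolding exp_add[symmetric] by (simp add: power_divide mult.commute)
    have "?e * hermite m (- L / of_real \<sigma>) = (?e * ?e') * ((- 1) ^ m * ?d)"
      unfolding hermite_def by (simp only: mult_ac)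
    then have "?e * hermite m (- L / of_real \<sigma>) = (- 1) ^ m * ?d"
      by (simp only: inv mult_1_left)
    then have "of_real ((- 1) ^ m * a_coeff N m / (sqrt (2 * pi) * \<sigma> ^ (m + 1)))
        * exp (- L\<^sup>2 / of_real (2 * \<sigma>\<^sup>2)) * hermite m (- L / of_real \<sigma>)
      = of_real ((- 1) ^ m * a_coeff N m / (sqrt (2 * pi) * \<sigma> ^ (m + 1))) * ((- 1) ^ m * ?d)"
      by (simp only: mult.assoc)
    also have "\<dots> = of_real (1 / (sqrt (2 * pi) * \<sigma>)) * (?d * of_real (a_coeff N m / \<sigma> ^ m))"
      by (simp add: mult_ac)
    finally show "of_real ((- 1) ^ m * a_coeff N m / (sqrt (2 * pi) * \<sigma> ^ (m + 1)))
        * exp (- L\<^sup>2 / of_real (2 * \<sigma>\<^sup>2)) * hermite m (- L / of_real \<sigma>)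
      = of_real (1 / (sqrt (2 * pi) * \<sigma>)) * (?d * of_real (a_coeff N m / \<sigma> ^ m))" .
  qed
  \<comment> \<open>Up to here everything is exact for each positive \<open>\<sigma>\<close>; only
    \<open>I \<sigma> - S \<sigma>\<close> remains to be estimated.\<close>
  have eq: "laplace_continuation (P \<sigma>) (X \<sigma>) z
      - ((\<Sum>n = 0..N. (- z) ^ n / fact n * of_real (exp (\<mu> * real n + \<sigma>\<^sup>2 / 2 * (real n)\<^sup>2))
            * (1 / 2 * erfc ((L + of_real (\<sigma>\<^sup>2 * real n)) / of_real (sqrt 2 * \<sigma>))))
        + (\<Sum>m = 0..M. of_real ((- 1) ^ m * a_coeff N m / (sqrt (2 * pi) * \<sigma> ^ (m + 1)))
            * exp (- L\<^sup>2 / of_real (2 * \<sigma>\<^sup>2)) * hermite m (- L / of_real \<sigma>)))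
      = of_real (1 / (sqrt (2 * pi) * \<sigma>)) * (I \<sigma> - S \<sigma>)" if "\<sigma> > 0" for \<sigma>
  proof -
    have "complex_of_real (1 / (sqrt (2 * pi) * \<sigma>)) * of_real (sqrt (2 * pi) * \<sigma>) = 1"
      using that by (simp flip: of_real_mult)
    then show ?thesis
      unfolding laplace_continuation_lognormal[OF assms(4)[OF that] assms(3), folded L_def]
        integral_exp_exp_gauss_kernel[OF that, of L N] main hermite I_def[symmetric]
      by (simp only: distrib_left right_diff_distrib mult.assoc[symmetric] mult_1_left) simp
  qed
  show ?thesis
    unfolding L_def[symmetric]
  \<comment> \<open>The threshold ensures \<open>\<sigma> > 0\<close> and
    \<open>norm L \<le> \<sigma>\<close>, as the remainder bound requires.\<close>
  proof (rule bigoI[of _ C], use eventually_ge_at_top[of "max 1 (norm L)"] in eventually_elim)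
    case (elim \<sigma>)
    then have \<sigma>: "\<sigma> > 0" "norm L \<le> \<sigma>" by auto
    have "norm (of_real (1 / (sqrt (2 * pi) * \<sigma>)) * (I \<sigma> - S \<sigma>)) = 1 / (sqrt (2 * pi) * \<sigma>) * norm (I \<sigma> - S \<sigma>)"
      using \<sigma>(1) unfolding norm_mult norm_of_real by simp
    also have "\<dots> \<le> 1 / (sqrt (2 * pi) * \<sigma>) * (C * sqrt (2 * pi) / \<sigma> ^ Suc M)"
      using integral_remainder_gauss_kernel_bound[OF \<sigma>, of N M] \<sigma>(1)
      by (intro mult_left_mono) (auto simp: I_def S_def C_def)
    \<comment> \<open>The normalising factor supplies one more \<open>1 / \<sigma>\<close>, raising
      the exponent from \<open>Suc M\<close> to \<open>M + 2\<close>.\<close>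
    also have "\<dots> = C * norm (complex_of_real (1 / \<sigma> ^ (M + 2)))"
      using \<sigma>(1) unfolding norm_of_real by simp
    finally show ?case unfolding eq[OF \<sigma>(1)] .
  qed
qed

end
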